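(* Let $1\le p<\infty$. For a Banach lattice $E$, the following are equivalent: (a) Every almost $p$-limited set in $E$ is relatively weakly compact. (b) Every positive $p$-limited set in $E$ is relatively weakly compact. (c) $E$ is a KB-space. (d) Every weakly Cauchy and almost $p$-limited sequence in $E$ is weakly convergent. (e) Every weakly Cauchy and positive $p$-limited sequence in $E$ is weakly convergent.
   Context: A KB-space is a Banach lattice in which every increasing norm bounded sequence of positive elements is norm convergent. A sequence $(x_n^* )_n\subset E^*$ is weak* $p$-summable if $(x_n^*(x))_n\in\ell_p$ for every $x\in E$; it is disjoint if its terms are pairwise disjoint and positive if all its terms are positive functionals. A subset $A$ of a Banach lattice $E$ is almost $p$-limited (resp. positive $p$-limited) if for each disjoint (resp. positive) weak* $p$-summable sequence $(x_n^* )_n\subset E^*$ there is $(a_n)_n\in\ell_p$ such that $|x_n^*(x)|\le a_n$ for every $x\in A$ and $n\in\mathbb{N}$. A sequence is said to be almost (resp. positive) $p$-limited if the set of its terms is. *)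

theory Defs
  imports "HOL-Analysis.Analysis" "HOL-Library.Lattice_Algebras"
begin

text \<open>
  Banach lattices are real. The modulus is the lattice one, \<open>\<bar>x\<bar> = sup x (- x)\<close>, by the
  class axiom \<open>abs_lattice\<close> of \<open>lattice_ab_group_add_abs\<close>.
\<close>

class banach_lattice = banach + ordered_real_vector + lattice_ab_group_add_abs +
  assumes norm_mono_abs: "\<bar>x\<bar> \<le> \<bar>y\<bar> \<Longrightarrow> norm x \<le> norm y"

instance real :: banach_lattice
  by standard simp

definition kb_space :: "'a::banach_lattice itself \<Rightarrow> bool" where
  "kb_space _ \<longleftrightarrow>
     (\<forall>x :: nat \<Rightarrow> 'a. incseq x \<and> (\<forall>n. 0 \<le> x n) \<and> bounded (range x) \<longrightarrow> convergent x)"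

text \<open>The initial topology of all continuous functionals; \<open>euclidean\<close> on a function type is
  the topology of pointwise convergence.\<close>

definition weak_topology :: "'a::real_normed_vector topology" where
  "weak_topology =
     pullback_topology UNIV (\<lambda>x (f :: 'a \<Rightarrow>\<^sub>L real). blinfun_apply f x) euclidean"

definition rel_weakly_compact :: "'a::real_normed_vector set \<Rightarrow> bool" where
  "rel_weakly_compact A \<longleftrightarrow> compactin weak_topology (weak_topology closure_of A)"

definition weakly_Cauchy :: "(nat \<Rightarrow> 'a::real_normed_vector) \<Rightarrow> bool" where
  "weakly_Cauchy x \<longleftrightarrow> (\<forall>f :: 'a \<Rightarrow>\<^sub>L real. Cauchy (\<lambda>n. blinfun_apply f (x n)))"

definition weakly_convergent :: "(nat \<Rightarrow> 'a::real_normed_vector) \<Rightarrow> bool" where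
  "weakly_convergent x \<longleftrightarrow> (\<exists>l. limitin weak_topology x l sequentially)"

definition dual_le :: "('a::banach_lattice \<Rightarrow>\<^sub>L real) \<Rightarrow> ('a \<Rightarrow>\<^sub>L real) \<Rightarrow> bool" where
  "dual_le f g \<longleftrightarrow> (\<forall>x\<ge>0. blinfun_apply f x \<le> blinfun_apply g x)"

definition dual_is_sup ::
    "('a::banach_lattice \<Rightarrow>\<^sub>L real) \<Rightarrow> ('a \<Rightarrow>\<^sub>L real) \<Rightarrow> ('a \<Rightarrow>\<^sub>L real) \<Rightarrow> bool" where
  "dual_is_sup f g h \<longleftrightarrow>
     dual_le f h \<and> dual_le g h \<and> (\<forall>k. dual_le f k \<and> dual_le g k \<longrightarrow> dual_le h k)"

definition dual_is_inf ::
    "('a::banach_lattice \<Rightarrow>\<^sub>L real) \<Rightarrow> ('a \<Rightarrow>\<^sub>L real) \<Rightarrow> ('a \<Rightarrow>\<^sub>L real) \<Rightarrow> bool" where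
  "dual_is_inf f g h \<longleftrightarrow>
     dual_le h f \<and> dual_le h g \<and> (\<forall>k. dual_le k f \<and> dual_le k g \<longrightarrow> dual_le k h)"

text \<open>
  Disjointness \<open>inf \<bar>f\<bar> \<bar>g\<bar> = 0\<close> in the vector lattice \<open>E\<^sup>*\<close>, whose lattice operations are
  given here as relations: \<open>u\<close> and \<open>v\<close> are the moduli of \<open>f\<close> and \<open>g\<close>. By the
  Riesz-Kantorovich theorem these suprema and infima always exist, and as \<open>dual_le\<close> is
  antisymmetric they are unique.
\<close>

definition dual_disjoint :: "('a::banach_lattice \<Rightarrow>\<^sub>L real) \<Rightarrow> ('a \<Rightarrow>\<^sub>L real) \<Rightarrow> bool" where
  "dual_disjoint f g \<longleftrightarrow>
     (\<exists>u v. dual_is_sup f (- f) u \<and> dual_is_sup g (- g) v \<and> dual_is_inf u v 0)"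

definition disjoint_seq :: "(nat \<Rightarrow> 'a::banach_lattice \<Rightarrow>\<^sub>L real) \<Rightarrow> bool" where
  "disjoint_seq f \<longleftrightarrow> (\<forall>m n. m \<noteq> n \<longrightarrow> dual_disjoint (f m) (f n))"

definition positive_seq :: "(nat \<Rightarrow> 'a::banach_lattice \<Rightarrow>\<^sub>L real) \<Rightarrow> bool" where
  "positive_seq f \<longleftrightarrow> (\<forall>n. dual_le 0 (f n))"

definition lp_seq :: "real \<Rightarrow> (nat \<Rightarrow> real) set" where
  "lp_seq p = {a. summable (\<lambda>n. \<bar>a n\<bar> powr p)}"

definition weak_star_p_summable ::
    "real \<Rightarrow> (nat \<Rightarrow> 'a::real_normed_vector \<Rightarrow>\<^sub>L real) \<Rightarrow> bool" where
  "weak_star_p_summable p f \<longleftrightarrow> (\<forall>x. (\<lambda>n. blinfun_apply (f n) x) \<in> lp_seq p)"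

definition almost_p_limited :: "real \<Rightarrow> 'a::banach_lattice set \<Rightarrow> bool" where
  "almost_p_limited p A \<longleftrightarrow>
     (\<forall>f :: nat \<Rightarrow> 'a \<Rightarrow>\<^sub>L real. disjoint_seq f \<and> weak_star_p_summable p f \<longrightarrow>
        (\<exists>a\<in>lp_seq p. \<forall>x\<in>A. \<forall>n. \<bar>blinfun_apply (f n) x\<bar> \<le> a n))"

definition positive_p_limited :: "real \<Rightarrow> 'a::banach_lattice set \<Rightarrow> bool" where
  "positive_p_limited p A \<longleftrightarrow>
     (\<forall>f :: nat \<Rightarrow> 'a \<Rightarrow>\<^sub>L real. positive_seq f \<and> weak_star_p_summable p f \<longrightarrow>
        (\<exists>a\<in>lp_seq p. \<forall>x\<in>A. \<forall>n. \<bar>blinfun_apply (f n) x\<bar> \<le> a n))"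

end

theory Submission
  imports Defs
begin

text \<open>
  The implications proved are (a) \<open>\<Longrightarrow>\<close> (b) \<open>\<Longrightarrow>\<close> (e) \<open>\<Longrightarrow>\<close> (c) \<open>\<Longrightarrow>\<close> (a) and
  (a) \<open>\<Longrightarrow>\<close> (d) \<open>\<Longrightarrow>\<close> (e).

  Positive \<open>p\<close>-limited sets are almost \<open>p\<close>-limited (\<open>positive_imp_almost_p_limited\<close>), because
  the positive parts of a disjoint weak* \<open>p\<close>-summable sequence are again weak* \<open>p\<close>-summable:
  disjoint functionals act on different pieces of a vector, so finitely many positive parts can be
  attained, up to an error, at the same vector. This gives (a) \<open>\<Longrightarrow>\<close> (b) and (d) \<open>\<Longrightarrow>\<close> (e). A weakly
  Cauchy sequence with relatively weakly compact range converges weakly, which gives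
  (a) \<open>\<Longrightarrow>\<close> (d) and (b) \<open>\<Longrightarrow>\<close> (e).

  For (e) \<open>\<Longrightarrow>\<close> (c), a norm bounded increasing sequence of positive elements is weakly Cauchy, and it
  is positive \<open>p\<close>-limited by the uniform boundedness of \<open>x \<mapsto> (f\<^sub>k(x))\<^sub>k \<in> \<ell>\<^sub>p\<close>. By (e) it converges weakly,
  and a weakly convergent increasing sequence converges in norm.

  For (c) \<open>\<Longrightarrow>\<close> (a), let \<open>A\<close> be almost \<open>p\<close>-limited. Order bounded disjoint sequences in \<open>E\<^sup>*\<close> are
  weak* 1-summable, so they tend to zero uniformly on \<open>A\<close>, and even on the set \<open>B\<close> of positive parts
  of elements of \<open>A\<close>. The same holds for \<open>- A\<close>, so it is enough to deal with \<open>B\<close>. It has to be shown that every weak* limit \<open>\<phi>\<close> of \<open>B\<close> in the bidual is given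
  by an element of \<open>E\<close> (\<open>kb_space_closure_is_evaluation\<close>). On each order interval \<open>[0, f]\<close> of \<open>E\<^sup>*\<close>
  such a \<open>\<phi>\<close> is absolutely continuous with respect to some \<open>u \<in> E\<close>, since otherwise a disjointification
  produces an order bounded disjoint sequence that is not uniformly null on \<open>B\<close>. In a KB-space
  there is a largest \<open>x \<in> E\<close> below \<open>\<phi>\<close>. If \<open>\<phi> - x\<close> were not zero, a Hahn decomposition
  of \<open>\<phi> - x - \<lambda> u\<close> on \<open>[0, f]\<close> would produce a nonzero positive element of \<open>E\<close> below \<open>\<phi> - x\<close>, against
  the choice of \<open>x\<close>.

  The Hahn-Banach theorem is proved in the form that every sublinear function dominates a linear one,
  by observing that a minimal sublinear function is linear.
\<close>

section \<open>Order and norm in a Banach lattice\<close>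

lemma norm_mono_pos:
  fixes x y :: "'a::banach_lattice"
  assumes "0 \<le> x" "x \<le> y"
  shows "norm x \<le> norm y"
proof (rule norm_mono_abs)
  have "0 \<le> y" using assms by (rule order_trans)
  then show "\<bar>x\<bar> \<le> \<bar>y\<bar>" using assms by simp
qed

lemma norm_abs_eq [simp]: "norm \<bar>x::'a::banach_lattice\<bar> = norm x"
  by (intro antisym norm_mono_abs) simp_all

lemma pprt_le_abs: "pprt x \<le> \<bar>x::'a::banach_lattice\<bar>"
  by (simp add: pprt_def abs_ge_self)

lemma pprt_split: "(x::'a::banach_lattice) = pprt x - pprt (- x)"
  using prts[of x] by (simp add: pprt_neg)

lemma norm_pprt_le: "norm (pprt x) \<le> norm (x::'a::banach_lattice)"
  using norm_mono_pos[OF zero_le_pprt pprt_le_abs, of x] by simp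

lemma pprt_add_le: "pprt (x + y) \<le> pprt x + pprt (y::'a::banach_lattice)"
  by (subst pprt_def, rule sup_least) (auto simp: pprt_def intro: add_mono add_nonneg_nonneg)

lemma pprt_ge_self: "x \<le> pprt (x::'a::banach_lattice)"
  by (simp add: pprt_def)

lemma pprt_scaleR:
  fixes x :: "'a::banach_lattice"
  assumes "0 \<le> c"
  shows "pprt (c *\<^sub>R x) = c *\<^sub>R pprt x"
proof (cases "c = 0")
  case False
  with assms have c: "c > 0" by simp
  have le: "pprt (d *\<^sub>R y) \<le> d *\<^sub>R pprt y" if "d > 0" for d and y :: 'a
    by (subst pprt_def, rule sup_least)
       (use that in \<open>auto intro!: scaleR_left_mono scaleR_nonneg_nonneg pprt_ge_self\<close>)
  have "pprt x \<le> (1/c) *\<^sub>R pprt (c *\<^sub>R x)"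
    using le[of "1/c" "c *\<^sub>R x"] c by simp
  then have "c *\<^sub>R pprt x \<le> c *\<^sub>R (1/c) *\<^sub>R pprt (c *\<^sub>R x)"
    using c by (intro scaleR_left_mono) auto
  with le[OF c, of x] c show ?thesis by (simp add: antisym)
qed simp

lemma sup_eq_add_pprt: "sup x y = x + pprt (y - x)" for x y :: "'a::banach_lattice"
  by (simp add: pprt_def add_sup_distrib_left sup.commute)

lemma inf_eq_diff_pprt: "inf x y = x - pprt (x - y)" for x y :: "'a::banach_lattice"
proof -
  have "inf x y = x + inf 0 (y - x)" by (simp add: add_inf_distrib_left)
  also have "inf 0 (y - x) = - pprt (x - y)"
    by (simp add: pprt_def neg_sup_eq_inf inf.commute)
  finally show ?thesis by simp
qed

text \<open>The lattice operations are norm continuous, because the modulus dominates the change of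
  the positive part.\<close>

lemma norm_pprt_diff_le: "norm (pprt x - pprt y) \<le> norm (x - y)"
  for x y :: "'a::banach_lattice"
proof -
  have 1: "pprt x - pprt y \<le> \<bar>x - y\<bar>" for x y :: 'a
  proof -
    have "pprt x \<le> pprt y + pprt (x - y)" using pprt_add_le[of y "x - y"] by simp
    also have "\<dots> \<le> pprt y + \<bar>x - y\<bar>" by (intro add_left_mono pprt_le_abs)
    finally show ?thesis by (simp add: algebra_simps)
  qed
  have "\<bar>pprt x - pprt y\<bar> \<le> \<bar>x - y\<bar>"
    using 1[of x y] 1[of y x] by (intro abs_leI) (auto simp: abs_minus_commute)
  then show ?thesis by (rule norm_mono_abs)
qed

lemma tendsto_pprt:
  fixes l :: "'a::banach_lattice"
  assumes "(f \<longlongrightarrow> l) F"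
  shows "((\<lambda>x. pprt (f x)) \<longlongrightarrow> pprt l) F"
proof (rule Lim_transform2)
  show "((\<lambda>x. pprt l) \<longlongrightarrow> pprt l) F" by simp
  have "((\<lambda>x. norm (l - f x)) \<longlongrightarrow> 0) F"
    using tendsto_norm[OF tendsto_diff[OF tendsto_const assms, of l]] by simp
  then show "((\<lambda>x. pprt l - pprt (f x)) \<longlongrightarrow> 0) F"
    by (rule Lim_null_comparison[rotated]) (simp add: norm_pprt_diff_le)
qed

lemma tendsto_nonneg:
  fixes l :: "'a::banach_lattice"
  assumes "x \<longlonglongrightarrow> l" "\<And>n. n \<ge> N \<Longrightarrow> 0 \<le> x n"
  shows "0 \<le> l"
proof -
  have "(\<lambda>n. pprt (x (n + N)) - x (n + N)) \<longlonglongrightarrow> pprt l - l"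
    using LIMSEQ_ignore_initial_segment[OF assms(1)] by (intro tendsto_diff tendsto_pprt)
  moreover have "(\<lambda>n. pprt (x (n + N)) - x (n + N)) = (\<lambda>_. 0)" using assms(2) by auto
  ultimately have "pprt l = l" using LIMSEQ_unique[OF _ tendsto_const] by fastforce
  then show ?thesis by (metis zero_le_pprt)
qed

lemma tendsto_le_lattice:
  fixes x y :: "nat \<Rightarrow> 'a::banach_lattice"
  assumes "x \<longlonglongrightarrow> l" "y \<longlonglongrightarrow> m" "\<And>n. n \<ge> N \<Longrightarrow> x n \<le> y n"
  shows "l \<le> m"
  using tendsto_nonneg[OF tendsto_diff[OF assms(2,1)], of N] assms(3) by simp

text \<open>The Riesz decomposition property: splitting off \<open>inf z x\<close> leaves at most \<open>y\<close>.\<close>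

lemma riesz_decomposition:
  fixes x y z :: "'a::banach_lattice"
  assumes "0 \<le> x" "0 \<le> y" "0 \<le> z" "z \<le> x + y"
  obtains a b where "0 \<le> a" "a \<le> x" "0 \<le> b" "b \<le> y" "z = a + b"
proof
  show "0 \<le> inf z x" "inf z x \<le> x" using assms by auto
  show "0 \<le> z - inf z x" using inf_le1[of z x] by (simp only: diff_ge_0_iff_ge)
  have "z - inf z x = pprt (z - x)" by (simp add: inf_eq_diff_pprt)
  also have "\<dots> \<le> y" unfolding pprt_def using assms by (auto simp: algebra_simps)
  finally show "z - inf z x \<le> y" .
  show "z = inf z x + (z - inf z x)" by (metis add.commute diff_add_cancel)
qed

section \<open>Positive functionals and the lattice structure of the dual\<close>

lemma dual_le_refl [simp]: "dual_le f f"
  and dual_le_trans: "dual_le f g \<Longrightarrow> dual_le g h \<Longrightarrow> dual_le f h"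
  by (auto simp: dual_le_def intro: order_trans)

lemma dual_leI: "(\<And>x. 0 \<le> x \<Longrightarrow> f x \<le> g x) \<Longrightarrow> dual_le f g"
  and dual_leD: "dual_le f g \<Longrightarrow> 0 \<le> x \<Longrightarrow> f x \<le> g x"
  for f g :: "'a::banach_lattice \<Rightarrow>\<^sub>L real"
  by (auto simp: dual_le_def)

lemma dual_posD: "dual_le 0 f \<Longrightarrow> 0 \<le> x \<Longrightarrow> 0 \<le> f x"
  for f :: "'a::banach_lattice \<Rightarrow>\<^sub>L real"
  by (auto simp: dual_le_def)

lemma dual_pos_mono:
  fixes f :: "'a::banach_lattice \<Rightarrow>\<^sub>L real"
  assumes "dual_le 0 f" "x \<le> y"
  shows "f x \<le> f y"
  using dual_posD[OF assms(1), of "y - x"] assms(2) by (simp add: blinfun.diff_right)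

lemma dual_pos_abs_le:
  fixes f :: "'a::banach_lattice \<Rightarrow>\<^sub>L real"
  assumes "dual_le 0 f"
  shows "\<bar>f x\<bar> \<le> f \<bar>x\<bar>"
  using dual_pos_mono[OF assms abs_ge_self, of x] dual_pos_mono[OF assms abs_ge_minus_self, of x]
  by (simp add: abs_le_iff blinfun.minus_right)

lemma dual_le_antisym:
  fixes f g :: "'a::banach_lattice \<Rightarrow>\<^sub>L real"
  assumes "dual_le f g" "dual_le g f"
  shows "f = g"
proof (rule blinfun_eqI)
  have eq: "f x = g x" if "0 \<le> x" for x
    using assms that by (auto simp: dual_le_def intro: antisym)
  fix x
  have "f (pprt x - pprt (- x)) = g (pprt x - pprt (- x))"
    by (simp add: blinfun.diff_right eq)
  then show "f x = g x" using pprt_split[of x] by simp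
qed

text \<open>A functional of \<open>E\<^sup>*\<close> is best given by its values on the positive cone. Additivity alone
  forces homogeneity, because the values are monotone along each ray.\<close>

lemma additive_on_cone_homogeneous:
  fixes q :: "'a::banach_lattice \<Rightarrow> real"
  assumes add: "\<And>x y. 0 \<le> x \<Longrightarrow> 0 \<le> y \<Longrightarrow> q (x + y) = q x + q y"
    and nonneg: "\<And>x. 0 \<le> x \<Longrightarrow> 0 \<le> q x" and "0 \<le> x" "0 \<le> c"
  shows "q (c *\<^sub>R x) = c * q x"
proof -
  have zero: "q 0 = 0" using add[of 0 0] by simp
  have mono: "q y \<le> q z" if "0 \<le> y" "y \<le> z" for y z
    using add[of y "z - y"] nonneg[of "z - y"] that by simp
  have nat: "q (real n *\<^sub>R y) = real n * q y" if "0 \<le> y" for n y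
  proof (induction n)
    case (Suc n)
    have "q (real (Suc n) *\<^sub>R y) = q (real n *\<^sub>R y + y)"
      by (simp add: algebra_simps)
    then show ?case using Suc add[of "real n *\<^sub>R y" y] that
      by (simp add: scaleR_nonneg_nonneg algebra_simps)
  qed (simp add: zero)
  have close: "real n * \<bar>q (c *\<^sub>R x) - c * q x\<bar> \<le> q x" for n
  proof -
    define k where "k = nat \<lfloor>real n * c\<rfloor>"
    have "0 \<le> real n * c" using assms by simp
    then have k: "real k \<le> real n * c" "real n * c \<le> real (Suc k)"
      unfolding k_def by linarith+
    have "q (real k *\<^sub>R x) \<le> q (real n *\<^sub>R c *\<^sub>R x)"
      using k assms by (intro mono) (auto intro: scaleR_right_mono scaleR_nonneg_nonneg)
    moreover have "q (real n *\<^sub>R c *\<^sub>R x) \<le> q (real (Suc k) *\<^sub>R x)"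
      using k assms by (intro mono)
        (auto simp del: of_nat_Suc intro: scaleR_right_mono scaleR_nonneg_nonneg)
    ultimately have b: "real k * q x \<le> real n * q (c *\<^sub>R x)"
        "real n * q (c *\<^sub>R x) \<le> real (Suc k) * q x"
      using nat[OF \<open>0 \<le> x\<close>] nat[of "c *\<^sub>R x"] assms
      by (auto simp: scaleR_nonneg_nonneg simp del: of_nat_Suc)
    have "real k * q x \<le> real n * c * q x" "real n * c * q x \<le> real (Suc k) * q x"
      using k nonneg[OF \<open>0 \<le> x\<close>] by (auto intro!: mult_right_mono)
    with b have "\<bar>real n * q (c *\<^sub>R x) - real n * c * q x\<bar> \<le> q x"
      by (simp add: abs_le_iff algebra_simps)
    then show ?thesis
      by (metis abs_mult abs_of_nat mult.assoc right_diff_distrib)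
  qed
  show ?thesis
  proof (rule ccontr)
    assume "q (c *\<^sub>R x) \<noteq> c * q x"
    then have "\<bar>q (c *\<^sub>R x) - c * q x\<bar> > 0" by simp
    then obtain n where "real n * \<bar>q (c *\<^sub>R x) - c * q x\<bar> > q x"
      using reals_Archimedean3 by blast
    with close[of n] show False by simp
  qed
qed

text \<open>The extension is \<open>x \<mapsto> q(x\<^sup>+) - q(x\<^sup>-)\<close>. It is linear because, for \<open>a, b \<ge> 0\<close>, the number \<open>q(a) - q(b)\<close>
  depends only on \<open>a - b\<close>.\<close>

lemma dual_from_cone:
  fixes q :: "'a::banach_lattice \<Rightarrow> real"
  assumes add: "\<And>x y. 0 \<le> x \<Longrightarrow> 0 \<le> y \<Longrightarrow> q (x + y) = q x + q y"
    and nonneg: "\<And>x. 0 \<le> x \<Longrightarrow> 0 \<le> q x"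
    and bound: "\<And>x. 0 \<le> x \<Longrightarrow> q x \<le> B * norm x"
  shows "\<exists>g :: 'a \<Rightarrow>\<^sub>L real. \<forall>x\<ge>0. g x = q x"
proof -
  define g where "g x = q (pprt x) - q (pprt (- x))" for x
  note hom = additive_on_cone_homogeneous[of q, OF add nonneg]
  have diff: "g (a - b) = q a - q b" if "0 \<le> a" "0 \<le> b" for a b
  proof -
    have "pprt (a - b) + b = pprt (- (a - b)) + a"
      using pprt_split[of "a - b"] by (simp add: algebra_simps)
    then have "q (pprt (a - b) + b) = q (pprt (- (a - b)) + a)" by (rule arg_cong)
    then have "q (pprt (a - b)) + q b = q (pprt (- (a - b))) + q a"
      by (simp only: add[OF zero_le_pprt that(1)] add[OF zero_le_pprt that(2)])
    then show ?thesis by (simp add: g_def)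
  qed
  have gadd: "g (x + y) = g x + g y" for x y
  proof -
    have "x + y = (pprt x + pprt y) - (pprt (- x) + pprt (- y))"
      by (simp only: add_diff_add pprt_split[symmetric])
    then have "g (x + y) = q (pprt x + pprt y) - q (pprt (- x) + pprt (- y))"
      using diff[of "pprt x + pprt y" "pprt (- x) + pprt (- y)"]
      by (simp add: add_nonneg_nonneg)
    then show ?thesis
      by (simp only: add zero_le_pprt g_def)
  qed
  have gneg: "g (- x) = - g x" for x by (simp add: g_def)
  have gscale: "g (c *\<^sub>R x) = c * g x" for c x
  proof -
    have pos: "g (c *\<^sub>R x) = c * g x" if "0 \<le> c" for c x
    proof -
      have "- (c *\<^sub>R x) = c *\<^sub>R (- x)" by simp
      then have "pprt (- (c *\<^sub>R x)) = c *\<^sub>R pprt (- x)" using pprt_scaleR[OF that] by metis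
      then show ?thesis
        unfolding g_def using that by (simp add: pprt_scaleR hom right_diff_distrib)
    qed
    show ?thesis
    proof (cases "0 \<le> c")
      case False
      then have "g ((- c) *\<^sub>R x) = (- c) * g x" by (intro pos) auto
      then show ?thesis using gneg[of "c *\<^sub>R x"] by simp
    qed (rule pos)
  qed
  have B0: "q (pprt z) \<le> \<bar>B\<bar> * norm x" if "norm (pprt z) \<le> norm x" for z x
  proof -
    have "q (pprt z) \<le> B * norm (pprt z)" by (rule bound) simp
    also have "\<dots> \<le> \<bar>B\<bar> * norm x" using that by (intro mult_mono) auto
    finally show ?thesis .
  qed
  have "bounded_linear g"
  proof (rule bounded_linear_intro)
    show "norm (g x) \<le> norm x * \<bar>B\<bar>" for x
      using B0[of x x] B0[of "- x" x] nonneg[of "pprt x"] nonneg[of "pprt (- x)"]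
        norm_pprt_le[of x] norm_pprt_le[of "- x"]
      by (simp add: g_def mult.commute abs_le_iff)
  qed (simp_all add: gadd gscale)
  moreover have "g x = q x" if "0 \<le> x" for x
    using diff[of x 0] add[of 0 0] that by simp
  ultimately show ?thesis
    using bounded_linear_Blinfun_apply by metis
qed

lemma dual_le_norm: "f x \<le> norm f * norm x" for f :: "'a::real_normed_vector \<Rightarrow>\<^sub>L real"
  using norm_blinfun[of f x] by simp

text \<open>The Riesz-Kantorovich formula describes the positive part in the dual by its values on the
  positive cone.\<close>

definition dual_pprt :: "('a::banach_lattice \<Rightarrow>\<^sub>L real) \<Rightarrow> 'a \<Rightarrow>\<^sub>L real" where
  "dual_pprt f = (SOME g. \<forall>x\<ge>0. blinfun_apply g x = Sup (blinfun_apply f ` {0..x}))"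

lemma bdd_above_dual_interval:
  "bdd_above (blinfun_apply f ` {0..x})" for f :: "'a::banach_lattice \<Rightarrow>\<^sub>L real"
proof (rule bdd_aboveI2)
  fix y assume "y \<in> {0..x}"
  then have "norm y \<le> norm x" by (auto intro: norm_mono_pos)
  then show "f y \<le> norm f * norm x"
    by (meson dual_le_norm mult_left_mono norm_ge_zero order_trans)
qed

lemma dual_pprt_eq:
  fixes f :: "'a::banach_lattice \<Rightarrow>\<^sub>L real"
  assumes "0 \<le> x"
  shows "dual_pprt f x = Sup (f ` {0..x})"
proof -
  define q where "q x = Sup (f ` {0..x})" for x
  note bdd = bdd_above_dual_interval[of f]
  have ge: "f y \<le> q x" if "0 \<le> y" "y \<le> x" for x y
    unfolding q_def using bdd that by (intro cSUP_upper) auto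
  have least: "q x \<le> c" if "0 \<le> x" "\<And>y. 0 \<le> y \<Longrightarrow> y \<le> x \<Longrightarrow> f y \<le> c" for x c
    unfolding q_def using that by (intro cSUP_least) auto
  have "\<exists>g :: 'a \<Rightarrow>\<^sub>L real. \<forall>x\<ge>0. g x = q x"
  proof (rule dual_from_cone)
    fix x y :: 'a assume xy: "0 \<le> x" "0 \<le> y"
    show "q (x + y) = q x + q y"
    proof (rule antisym)
      show "q (x + y) \<le> q x + q y"
      proof (rule least)
        fix z assume "0 \<le> z" "z \<le> x + y"
        then obtain a b where "0 \<le> a" "a \<le> x" "0 \<le> b" "b \<le> y" "z = a + b"
          using riesz_decomposition xy by metis
        then show "f z \<le> q x + q y"
          using ge[of a x] ge[of b y] by (simp add: blinfun.add_right)
      qed (use xy in auto)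
      have "q x \<le> q (x + y) - f b" if "0 \<le> b" "b \<le> y" for b
      proof (rule least)
        fix a assume "0 \<le> a" "a \<le> x"
        then show "f a \<le> q (x + y) - f b"
          using ge[of "a + b" "x + y"] that by (simp add: blinfun.add_right add_mono)
      qed (use xy in auto)
      then have "q y \<le> q (x + y) - q x"
        using xy by (intro least) (auto simp: algebra_simps)
      then show "q x + q y \<le> q (x + y)" by simp
    qed
  next
    fix x :: 'a assume x: "0 \<le> x"
    show "0 \<le> q x" using ge[of 0 x] x by (simp add: blinfun.zero_right)
    show "q x \<le> norm f * norm x"
    proof (rule least[OF x])
      fix y assume "0 \<le> y" "y \<le> x"
      then have "norm y \<le> norm x" by (rule norm_mono_pos)
      then show "f y \<le> norm f * norm x"
        by (meson dual_le_norm mult_left_mono norm_ge_zero order_trans)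
    qed
  qed
  then have "\<forall>x\<ge>0. dual_pprt f x = Sup (f ` {0..x})"
    unfolding dual_pprt_def q_def by (rule someI_ex)
  with assms show ?thesis by blast
qed

lemma dual_pprt_ge: "0 \<le> y \<Longrightarrow> y \<le> x \<Longrightarrow> f y \<le> dual_pprt f x"
  for f :: "'a::banach_lattice \<Rightarrow>\<^sub>L real"
  using bdd_above_dual_interval[of f x]
  by (subst dual_pprt_eq) (auto intro!: cSUP_upper intro: order_trans)

lemma dual_pprt_least:
  "0 \<le> x \<Longrightarrow> (\<And>y. 0 \<le> y \<Longrightarrow> y \<le> x \<Longrightarrow> f y \<le> c) \<Longrightarrow> dual_pprt f x \<le> c"
  for f :: "'a::banach_lattice \<Rightarrow>\<^sub>L real"
  by (subst dual_pprt_eq) (auto intro!: cSUP_least)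

lemma dual_pprt_approx:
  fixes f :: "'a::banach_lattice \<Rightarrow>\<^sub>L real"
  assumes "0 \<le> x" "0 < e"
  obtains y where "0 \<le> y" "y \<le> x" "dual_pprt f x - e < f y"
proof -
  have "\<exists>y. 0 \<le> y \<and> y \<le> x \<and> dual_pprt f x - e < f y"
  proof (rule ccontr)
    assume "\<not> ?thesis"
    then have "dual_pprt f x \<le> dual_pprt f x - e"
      using assms by (intro dual_pprt_least) (auto simp: not_less)
    with assms show False by simp
  qed
  then show ?thesis using that by blast
qed

lemma dual_pprt_nonneg [simp]: "dual_le 0 (dual_pprt f)"
  by (rule dual_leI) (metis blinfun.zero_right dual_pprt_ge order_refl zero_blinfun.rep_eq)

lemma dual_pprt_ge_self: "dual_le f (dual_pprt f)"
  by (rule dual_leI) (rule dual_pprt_ge, auto)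

lemma dual_pprt_minimal:
  fixes f g :: "'a::banach_lattice \<Rightarrow>\<^sub>L real"
  assumes "dual_le 0 g" "dual_le f g"
  shows "dual_le (dual_pprt f) g"
proof (rule dual_leI)
  fix x :: 'a assume "0 \<le> x"
  then show "dual_pprt f x \<le> g x"
  proof (rule dual_pprt_least)
    fix y assume "0 \<le> y" "y \<le> x"
    then show "f y \<le> g x"
      using dual_leD[OF assms(2), of y] dual_pos_mono[OF assms(1), of y x] by linarith
  qed
qed

lemma dual_pprt_mono: "dual_le f g \<Longrightarrow> dual_le (dual_pprt f) (dual_pprt g)"
  by (meson dual_le_trans dual_pprt_ge_self dual_pprt_minimal dual_pprt_nonneg)

lemma dual_pprt_minus: "dual_pprt (- f) = dual_pprt f - f"
proof (rule dual_le_antisym)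
  have "dual_le (- f) (dual_pprt f - f)"
    using dual_pprt_nonneg[of f] by (simp add: dual_le_def blinfun.bilinear_simps)
  moreover have "dual_le 0 (dual_pprt f - f)"
    using dual_pprt_ge_self[of f] by (simp add: dual_le_def blinfun.bilinear_simps)
  ultimately show "dual_le (dual_pprt (- f)) (dual_pprt f - f)"
    by (rule dual_pprt_minimal[rotated])
  have "dual_le (dual_pprt f) (f + dual_pprt (- f))"
  proof (rule dual_pprt_minimal)
    show "dual_le 0 (f + dual_pprt (- f))"
      using dual_pprt_ge_self[of "- f"]
      by (simp add: dual_le_def blinfun.bilinear_simps) (smt (verit))
    show "dual_le f (f + dual_pprt (- f))"
      using dual_pprt_nonneg[of "- f"] by (simp add: dual_le_def blinfun.bilinear_simps)
  qed
  then show "dual_le (dual_pprt f - f) (dual_pprt (- f))"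
    by (simp add: dual_le_def blinfun.bilinear_simps algebra_simps)
qed

lemma dual_split: "f = dual_pprt f - dual_pprt (- f)"
  by (simp add: dual_pprt_minus)

text \<open>This makes the relational notion of disjointness in \<open>E\<^sup>*\<close> accessible to the Riesz-Kantorovich
  formula.\<close>

lemma dual_is_sup_modulus: "dual_is_sup f (- f) (dual_pprt f + dual_pprt (- f))"
  unfolding dual_is_sup_def
proof (intro conjI allI impI)
  show "dual_le f (dual_pprt f + dual_pprt (- f))"
    using dual_pprt_ge_self[of f] dual_pprt_nonneg[of "- f"]
    by (simp add: dual_le_def blinfun.bilinear_simps add_increasing2)
  show "dual_le (- f) (dual_pprt f + dual_pprt (- f))"
    using dual_pprt_ge_self[of "- f"] dual_pprt_nonneg[of "f"]
    by (simp add: dual_le_def blinfun.bilinear_simps) (smt (verit))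
  fix k assume k: "dual_le f k \<and> dual_le (- f) k"
  \<comment> \<open>\<open>2 f\<^sup>+ \<le> k + f\<close>, because the right-hand side is positive and dominates \<open>2 f\<close>.\<close>
  have "dual_le (dual_pprt f) ((1/2) *\<^sub>R (k + f))"
    using k by (intro dual_pprt_minimal)
      (auto simp: dual_le_def blinfun.bilinear_simps; smt (verit))+
  then show "dual_le (dual_pprt f + dual_pprt (- f)) k"
    unfolding dual_pprt_minus
    by (auto simp: dual_le_def blinfun.bilinear_simps; smt (verit))
qed

lemma dual_is_sup_unique: "dual_is_sup f g h \<Longrightarrow> dual_is_sup f g h' \<Longrightarrow> h = h'"
  by (auto simp: dual_is_sup_def intro: dual_le_antisym)

text \<open>The functional \<open>u - (u - v)\<^sup>+\<close> is a lower bound of \<open>u\<close> and \<open>v\<close>, so it is at most zero, and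
  \<open>(u - v)\<^sup>+(x)\<close> is approximated by the values of \<open>u - v\<close> on \<open>[0, x]\<close>.\<close>

lemma dual_inf_zero_split:
  fixes u v :: "'a::banach_lattice \<Rightarrow>\<^sub>L real"
  assumes "dual_is_inf u v 0" "0 \<le> x" "0 < e"
  obtains a where "0 \<le> a" "a \<le> x" "u (x - a) + v a < e"
proof -
  have "dual_le (u - dual_pprt (u - v)) 0"
  proof -
    have "dual_le (u - dual_pprt (u - v)) u"
      using dual_pprt_nonneg[of "u - v"] by (simp add: dual_le_def blinfun.bilinear_simps)
    moreover have "dual_le (u - dual_pprt (u - v)) v"
      using dual_pprt_ge_self[of "u - v"]
      by (simp add: dual_le_def blinfun.bilinear_simps algebra_simps)
    ultimately show ?thesis using assms(1) by (auto simp: dual_is_inf_def)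
  qed
  then have "u x \<le> dual_pprt (u - v) x"
    using assms(2) by (simp add: dual_le_def blinfun.bilinear_simps)
  moreover obtain a where "0 \<le> a" "a \<le> x" "dual_pprt (u - v) x - e < (u - v) a"
    using dual_pprt_approx assms(2,3) by metis
  ultimately show ?thesis
    by (intro that[of a]) (auto simp: blinfun.bilinear_simps)
qed

text \<open>The criterion by which functionals will be recognized as disjoint: they lie below multiples of
  the two parts of one functional \<open>h\<close>.\<close>

lemma dual_disjoint_of_parts:
  fixes h k l :: "'a::banach_lattice \<Rightarrow>\<^sub>L real"
  assumes "dual_le 0 k" "dual_le k (dual_pprt h)" "dual_le 0 l" "0 \<le> c"
    "dual_le l (c *\<^sub>R dual_pprt (- h))"
  shows "dual_is_inf k l 0"
  unfolding dual_is_inf_def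
proof (intro conjI allI impI)
  fix w assume w: "dual_le w k \<and> dual_le w l"
  show "dual_le w 0"
  proof (rule dual_leI, rule field_le_epsilon)
    fix x :: 'a and e :: real assume x: "0 \<le> x" and e: "0 < e"
    define d where "d = e / (1 + c)"
    have d: "0 < d" using e assms by (simp add: d_def)
    \<comment> \<open>\<open>h\<^sup>+\<close> almost lives on \<open>a\<close>, and \<open>h\<^sup>-\<close> on the remainder.\<close>
    obtain a where a: "0 \<le> a" "a \<le> x" "dual_pprt h x - d < h a"
      using dual_pprt_approx x d by metis
    have "dual_pprt h a \<le> dual_pprt h x"
      using a dual_pos_mono[OF dual_pprt_nonneg] by blast
    then have "dual_pprt (- h) a \<le> d"
      using a by (simp add: dual_pprt_minus blinfun.bilinear_simps)
    then have "c * dual_pprt (- h) a \<le> c * d" using assms(4) by (rule mult_left_mono)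
    moreover have "l a \<le> c * dual_pprt (- h) a"
      using dual_leD[OF assms(5) a(1)] by (simp add: blinfun.bilinear_simps)
    moreover have "w a \<le> l a" using w a by (auto simp: dual_le_def)
    moreover have "h a \<le> dual_pprt h a" using dual_pprt_ge[of a a] a by simp
    then have "dual_pprt h (x - a) \<le> d"
      using a by (simp add: blinfun.bilinear_simps)
    moreover have "w (x - a) \<le> k (x - a)" "k (x - a) \<le> dual_pprt h (x - a)"
      using w assms(2) a by (auto simp: dual_le_def)
    moreover have "w x = w a + w (x - a)" by (simp add: blinfun.bilinear_simps)
    ultimately have "w x \<le> (1 + c) * d" by (simp add: algebra_simps)
    then show "blinfun_apply w x \<le> blinfun_apply 0 x + e" using assms(4) by (simp add: d_def)
  qed
qed (use assms in auto)

lemma dual_disjoint_positive: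
  assumes "dual_le 0 k" "dual_le 0 l" "dual_is_inf k l 0"
  shows "dual_disjoint k l"
proof -
  have "dual_is_sup k (- k) k" if "dual_le 0 k" for k :: "'a \<Rightarrow>\<^sub>L real"
    using that by (auto simp: dual_is_sup_def dual_le_def blinfun.bilinear_simps)
  then show ?thesis using assms unfolding dual_disjoint_def by blast
qed

lemma dual_is_inf_zero_mono:
  assumes "dual_is_inf k l 0" "dual_le 0 k'" "dual_le k' k" "dual_le 0 l'" "dual_le l' l"
  shows "dual_is_inf k' l' 0"
  using assms dual_le_trans unfolding dual_is_inf_def by blast

text \<open>For \<open>x \<ge> 0\<close> the functional \<open>k\<close> restricts to the band generated by \<open>x\<close>, by
  \<open>y \<mapsto> sup\<^sub>t k (y \<and> t x)\<close>; this retains the mass of \<open>x\<^sup>+\<close> and forgets \<open>x\<^sup>-\<close>.\<close>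

lemma dual_restrict_to_pprt:
  fixes k :: "'a::banach_lattice \<Rightarrow>\<^sub>L real"
  assumes k: "dual_le 0 k"
  obtains l where "dual_le 0 l" "dual_le l k" "l x = k (pprt x)"
proof -
  define v where "v = pprt x"
  have v: "0 \<le> v" by (simp add: v_def)
  define q where "q y = (SUP t::nat. k (inf y (real t *\<^sub>R v)))" for y
  have bdd: "bdd_above (range (\<lambda>t. k (inf y (real t *\<^sub>R v))))" for y
    by (rule bdd_aboveI2[of _ _ "k y"]) (simp add: dual_pos_mono[OF k])
  have ge: "k (inf y (real t *\<^sub>R v)) \<le> q y" for y t
    unfolding q_def by (rule cSUP_upper2[OF bdd]) auto
  have least: "q y \<le> c" if "\<And>t. k (inf y (real t *\<^sub>R v)) \<le> c" for y c
    unfolding q_def by (rule cSUP_least) (use that in auto)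
  have le: "q y \<le> k y" for y by (rule least) (simp add: dual_pos_mono[OF k])
  have nonneg: "0 \<le> q y" if "0 \<le> y" for y
    using ge[of y 0] that by (simp add: inf_absorb2 blinfun.zero_right)
  have mono_t: "k (inf y (real s *\<^sub>R v)) \<le> k (inf y (real t *\<^sub>R v))" if "s \<le> t" for y s t
    using that v by (intro dual_pos_mono[OF k] inf_mono scaleR_right_mono) auto
  have "\<exists>g :: 'a \<Rightarrow>\<^sub>L real. \<forall>y\<ge>0. g y = q y"
  proof (rule dual_from_cone)
    fix y z :: 'a assume yz: "0 \<le> y" "0 \<le> z"
    show "q (y + z) = q y + q z"
    proof (rule antisym)
      show "q (y + z) \<le> q y + q z"
      proof (rule least)
        fix t :: nat
        let ?v = "real t *\<^sub>R v"
        have v': "0 \<le> ?v" using v by (simp add: scaleR_nonneg_nonneg)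
        \<comment> \<open>\<open>(y + z) \<and> v \<le> y \<and> v + z \<and> v\<close>\<close>
        have "inf (y + z) ?v \<le> inf y ?v + inf z ?v"
          unfolding add_inf_distrib_left add_inf_distrib_right using v' yz
          by (auto intro!: le_infI intro: le_infI1 le_infI2 add_increasing add_increasing2)
        then have "k (inf (y + z) ?v) \<le> k (inf y ?v) + k (inf z ?v)"
          using dual_pos_mono[OF k] by (metis blinfun.add_right)
        then show "k (inf (y + z) ?v) \<le> q y + q z"
          using ge[of y t] ge[of z t] by linarith
      qed
      have "k (inf y (real s *\<^sub>R v)) + k (inf z (real t *\<^sub>R v)) \<le> q (y + z)" for s t
      proof -
        have "inf y (real s *\<^sub>R v) + inf z (real t *\<^sub>R v) \<le> inf (y + z) (real (s + t) *\<^sub>R v)"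
          by (auto simp: scaleR_add_left intro!: le_infI add_mono)
        then have "k (inf y (real s *\<^sub>R v) + inf z (real t *\<^sub>R v))
            \<le> k (inf (y + z) (real (s + t) *\<^sub>R v))" by (rule dual_pos_mono[OF k])
        then show ?thesis using ge[of "y + z" "s + t"] by (simp add: blinfun.add_right)
      qed
      then have "q y \<le> q (y + z) - k (inf z (real t *\<^sub>R v))" for t
        by (intro least) (simp add: algebra_simps)
      then have "q z \<le> q (y + z) - q y" by (intro least) (simp add: algebra_simps)
      then show "q y + q z \<le> q (y + z)" by simp
    qed
  qed (use nonneg le dual_le_norm order_trans in blast)+
  then obtain l where l: "\<And>y. 0 \<le> y \<Longrightarrow> blinfun_apply l y = q y" by blast
  have "q v = k v" using ge[of v 1] le[of v] by simp
  moreover have "q (pprt (- x)) = 0"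
  proof (rule antisym[OF least nonneg])
    fix t :: nat
    \<comment> \<open>\<open>x\<^sup>-\<close> is disjoint from every multiple of \<open>x\<^sup>+\<close>.\<close>
    have disj: "inf (pprt (- x)) v = 0"
    proof -
      have "pprt (- x) = v - x" using pprt_split[of x] by (simp add: v_def algebra_simps)
      then have "inf (pprt (- x)) v = v + inf (- x) 0"
        by (simp add: add_inf_distrib_left)
      also have "inf (- x) 0 = - v"
        using pprt_neg[of x] nprt_neg[of x] by (simp add: v_def nprt_def)
      finally show ?thesis by simp
    qed
    have "inf (pprt (- x)) (real t *\<^sub>R v) \<le> 0"
    proof (cases "t = 0")
      case False
      define b where "b = inf (pprt (- x)) (real t *\<^sub>R v)"
      have b: "0 \<le> b" "b \<le> pprt (- x)" "b \<le> real t *\<^sub>R v"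
        using v by (auto simp: b_def scaleR_nonneg_nonneg)
      have "(1 / real t) *\<^sub>R b \<le> (1 / real t) *\<^sub>R real t *\<^sub>R v"
        using b by (intro scaleR_left_mono) auto
      then have "(1 / real t) *\<^sub>R b \<le> v" using False by simp
      moreover have "(1 / real t) *\<^sub>R b \<le> 1 *\<^sub>R b"
        using b False by (intro scaleR_right_mono) auto
      then have "(1 / real t) *\<^sub>R b \<le> pprt (- x)" using b(2) by (auto intro: order_trans)
      ultimately have "(1 / real t) *\<^sub>R b \<le> 0" using disj by (metis le_inf_iff)
      then have "real t *\<^sub>R (1 / real t) *\<^sub>R b \<le> real t *\<^sub>R 0"
        by (intro scaleR_left_mono) auto
      then show ?thesis using False by (simp add: b_def)
    qed simp
    then show "k (inf (pprt (- x)) (real t *\<^sub>R v)) \<le> 0"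
      using dual_pos_mono[OF k] by (metis blinfun.zero_right)
  qed simp
  moreover have "l x = l v - l (pprt (- x))"
    using pprt_split[of x] by (metis blinfun.diff_right v_def)
  ultimately have "l x = k (pprt x)" using l v by (simp add: v_def)
  moreover have "dual_le 0 l" "dual_le l k" using l nonneg le by (auto simp: dual_le_def)
  ultimately show ?thesis using that by blast
qed

section \<open>The Hahn-Banach theorem\<close>

definition sublinear :: "('a::real_vector \<Rightarrow> real) \<Rightarrow> bool" where
  "sublinear q \<longleftrightarrow> (\<forall>x y. q (x + y) \<le> q x + q y) \<and> (\<forall>c\<ge>0. \<forall>x. q (c *\<^sub>R x) = c * q x)"

lemma sublinearD:
  assumes "sublinear q"
  shows "q (x + y) \<le> q x + q y" "0 \<le> c \<Longrightarrow> q (c *\<^sub>R x) = c * q x"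
    "q 0 = 0" "0 \<le> q x + q (- x)"
proof -
  show 1: "q (x + y) \<le> q x + q y" for x y using assms by (simp add: sublinear_def)
  show "0 \<le> c \<Longrightarrow> q (c *\<^sub>R x) = c * q x" using assms by (simp add: sublinear_def)
  have "q (0 *\<^sub>R 0) = 0 * q 0" using assms unfolding sublinear_def by blast
  then show 0: "q 0 = 0" by simp
  show "0 \<le> q x + q (- x)" using 1[of x "- x"] 0 by simp
qed

text \<open>If \<open>q\<close> is sublinear then so is \<open>y \<mapsto> inf\<^sub>t (q (y + t x) - t q x)\<close>, which lies below \<open>q\<close>.
  A minimal sublinear function must agree with all of these, and this makes it additive.\<close>

lemma sublinear_shift:
  fixes q :: "'a::real_vector \<Rightarrow> real"
  assumes q: "sublinear q"
  obtains r where "sublinear r" "\<And>y. r y \<le> q y" "\<And>y. r y \<le> q (y + x) - q x"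
proof -
  define r where "r y = (INF t\<in>{0..}. q (y + t *\<^sub>R x) - t * q x)" for y
  note q' = sublinearD[OF q]
  have bdd: "bdd_below ((\<lambda>t. q (y + t *\<^sub>R x) - t * q x) ` {0..})" for y
  proof (rule bdd_belowI2)
    fix t :: real assume "t \<in> {0..}"
    then show "- q (- y) \<le> q (y + t *\<^sub>R x) - t * q x"
      using q'(1)[of "y + t *\<^sub>R x" "- y"] q'(2)[of t x] by simp
  qed
  have le: "r y \<le> q (y + t *\<^sub>R x) - t * q x" if "0 \<le> t" for t y
    unfolding r_def using that by (intro cINF_lower[OF bdd]) auto
  have ge: "c \<le> r y" if "\<And>t. 0 \<le> t \<Longrightarrow> c \<le> q (y + t *\<^sub>R x) - t * q x" for y c
    unfolding r_def using that by (intro cINF_greatest) auto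
  have "r (y + z) \<le> r y + r z" for y z
  proof -
    have "r (y + z) - (q (z + s *\<^sub>R x) - s * q x) \<le> r y" if s: "0 \<le> s" for s
    proof (rule ge)
      fix t :: real assume t: "0 \<le> t"
      have "y + z + (t + s) *\<^sub>R x = (y + t *\<^sub>R x) + (z + s *\<^sub>R x)" by (simp add: algebra_simps)
      then show "r (y + z) - (q (z + s *\<^sub>R x) - s * q x) \<le> q (y + t *\<^sub>R x) - t * q x"
        using le[of "t + s" "y + z"] s t q'(1)[of "y + t *\<^sub>R x" "z + s *\<^sub>R x"]
        by (simp add: algebra_simps)
    qed
    then have "r (y + z) - r y \<le> r z"
      by (intro ge) (simp add: algebra_simps)
    then show ?thesis by simp
  qed
  moreover have "r (c *\<^sub>R y) = c * r y" if "0 \<le> c" for c y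
  proof (cases "c = 0")
    case True
    have "r 0 = 0"
      using le[of 0 0] q'(3) by (intro antisym ge) (auto simp: q'(2))
    then show ?thesis using True by simp
  next
    case False
    with that have c: "0 < c" by simp
    have half: "d * r z \<le> r (d *\<^sub>R z)" if d: "0 < d" for d z
    proof (rule ge)
      fix t :: real assume t: "0 \<le> t"
      have "d *\<^sub>R z + t *\<^sub>R x = d *\<^sub>R (z + (t / d) *\<^sub>R x)" using d by (simp add: algebra_simps)
      then have "q (d *\<^sub>R z + t *\<^sub>R x) = d * q (z + (t / d) *\<^sub>R x)" using d by (simp add: q'(2))
      moreover have "d * r z \<le> d * (q (z + (t / d) *\<^sub>R x) - (t / d) * q x)"
        using le[of "t / d" z] d t by (intro mult_left_mono) auto
      ultimately show "d * r z \<le> q (d *\<^sub>R z + t *\<^sub>R x) - t * q x"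
        using d by (simp add: algebra_simps)
    qed
    have "(1 / c) * r (c *\<^sub>R y) \<le> r y" using half[of "1 / c" "c *\<^sub>R y"] c by simp
    then have "r (c *\<^sub>R y) \<le> c * r y" using c by (simp add: field_simps)
    with half[OF c, of y] show ?thesis by simp
  qed
  ultimately have "sublinear r" by (simp add: sublinear_def)
  moreover have "r y \<le> q y" "r y \<le> q (y + x) - q x" for y using le[of 0 y] le[of 1 y] by auto
  ultimately show ?thesis using that by blast
qed

text \<open>Zorn's lemma provides a minimal sublinear function below \<open>p\<close>, because the pointwise infimum of a
  chain of sublinear functions is sublinear.\<close>

theorem hahn_banach:
  fixes p :: "'a::real_vector \<Rightarrow> real"
  assumes p: "sublinear p"
  obtains f where "linear f" "\<And>x. f x \<le> p x"
proof -
  define S where "S = {q. sublinear q \<and> (\<forall>x. q x \<le> p x)}"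
  define R where "R = {(q, r). q \<in> S \<and> r \<in> S \<and> (\<forall>x. r x \<le> q x)}"
  have field: "Field R = S" unfolding R_def Field_def by auto
  have "partial_order_on (Field R) R"
    unfolding field
    by (auto simp: partial_order_on_def preorder_on_def R_def refl_on_def trans_def antisym_def
        intro: order_trans intro!: ext order_antisym)
  moreover have "\<exists>u\<in>Field R. \<forall>a\<in>C. (a, u) \<in> R" if C: "C \<in> Chains R" for C
  proof (cases "C = {}")
    case True
    then show ?thesis using p unfolding field S_def by auto
  next
    case False
    then obtain q0 where q0: "q0 \<in> C" by blast
    have CS: "q \<in> S" if "q \<in> C" for q using C that by (auto simp: Chains_def R_def)
    have cmp: "(\<forall>x. q x \<le> r x) \<or> (\<forall>x. r x \<le> q x)" if "q \<in> C" "r \<in> C" for q r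
      using C that by (auto simp: Chains_def R_def)
    define u where "u x = (INF q\<in>C. q x)" for x
    have bdd: "bdd_below ((\<lambda>q. q x) ` C)" for x
    proof (rule bdd_belowI2)
      fix q assume "q \<in> C"
      then have "sublinear q" "q (- x) \<le> p (- x)" using CS by (auto simp: S_def)
      then show "- p (- x) \<le> q x" using sublinearD(4)[of q x] by simp
    qed
    have le: "u x \<le> q x" if "q \<in> C" for q x unfolding u_def using bdd that by (intro cINF_lower)
    have ge: "c \<le> u x" if "\<And>q. q \<in> C \<Longrightarrow> c \<le> q x" for c x
      unfolding u_def using False that by (intro cINF_greatest)
    have "u (x + y) \<le> u x + u y" for x y
    proof -
      have "u (x + y) - r y \<le> u x" if r: "r \<in> C" for r
      proof (rule ge)
        fix q assume q: "q \<in> C"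
        show "u (x + y) - r y \<le> q x"
          using cmp[OF q r] le[OF q, of "x + y"] le[OF r, of "x + y"] CS[OF q] CS[OF r]
            sublinearD(1)[of q x y] sublinearD(1)[of r x y]
          unfolding S_def by (smt (verit) mem_Collect_eq)
      qed
      then have "u (x + y) - u x \<le> u y" by (intro ge) (simp add: algebra_simps)
      then show ?thesis by simp
    qed
    moreover have "u (c *\<^sub>R x) = c * u x" if c: "0 \<le> c" for c x
    proof -
      have hom: "q (d *\<^sub>R y) = d * q y" if "q \<in> C" "0 \<le> d" for q d y
        using CS[OF that(1)] that(2) by (auto simp: S_def sublinearD(2))
      have half: "d * u y \<le> u (d *\<^sub>R y)" if "0 \<le> d" for d y
        using that by (intro ge) (auto simp: hom intro: mult_left_mono le)
      show ?thesis
      proof (cases "c = 0")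
        case True
        have "q 0 = 0" if "q \<in> C" for q using hom[OF that, of 0 0] by simp
        then have "(\<lambda>q. q 0) ` C = {0}" using q0 by force
        then have "u 0 = 0" by (simp add: u_def)
        then show ?thesis using True by simp
      next
        case False
        have "(1 / c) * u (c *\<^sub>R x) \<le> u x" using half[of "1 / c" "c *\<^sub>R x"] c False by simp
        then have "u (c *\<^sub>R x) \<le> c * u x" using c False by (simp add: field_simps)
        with half[OF c, of x] show ?thesis by simp
      qed
    qed
    ultimately have "sublinear u" by (simp add: sublinear_def)
    moreover have "u x \<le> p x" for x using le[OF q0, of x] CS[OF q0] by (auto simp: S_def intro: order_trans)
    ultimately have "u \<in> S" by (simp add: S_def)
    then show ?thesis unfolding field using CS le by (intro bexI[of _ u]) (auto simp: R_def)
  qed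
  ultimately have "\<exists>m\<in>Field R. \<forall>q\<in>Field R. (m, q) \<in> R \<longrightarrow> q = m" by (rule Zorns_po_lemma)
  then obtain m where m: "m \<in> Field R" and min: "\<And>q. q \<in> Field R \<Longrightarrow> (m, q) \<in> R \<Longrightarrow> q = m"
    by blast
  have mS: "sublinear m" "\<And>x. m x \<le> p x" using m by (auto simp: field S_def)
  note m' = sublinearD[OF mS(1)]
  have add: "m (x + y) = m x + m y" for x y
  proof -
    obtain r where r: "sublinear r" "\<And>y. r y \<le> m y" "\<And>y. r y \<le> m (y + x) - m x"
      using sublinear_shift[OF mS(1), of x] by blast
    have "r \<in> S" using r(1) order_trans[OF r(2) mS(2)] by (simp add: S_def)
    moreover have "m \<in> S" using m field by simp
    ultimately have "(m, r) \<in> R" using r(2) by (simp add: R_def)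
    then have "r = m" using \<open>r \<in> S\<close> field by (intro min) auto
    then have "m y \<le> m (y + x) - m x" using r(3) by metis
    with m'(1)[of x y] show ?thesis by (simp add: add.commute)
  qed
  have neg: "m (- x) = - m x" for x using add[of x "- x"] m'(3) by simp
  have "m (c *\<^sub>R x) = c * m x" for c x
  proof (cases "0 \<le> c")
    case False
    then have "m ((- c) *\<^sub>R x) = (- c) * m x" by (intro m'(2)) auto
    then show ?thesis using neg[of "c *\<^sub>R x"] by simp
  qed (rule m'(2))
  with add have "linear m" by (intro linearI) auto
  with mS(2) show ?thesis using that by blast
qed

text \<open>A linear functional below \<open>x \<mapsto> \<parallel>x\<^sup>+\<parallel>\<close> is automatically positive and contractive, so in a
  Banach lattice the Hahn-Banach theorem directly delivers positive functionals.\<close>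

lemma positive_functional_from_sublinear:
  fixes p :: "'a::banach_lattice \<Rightarrow> real"
  assumes "sublinear p" and p: "\<And>x. p x \<le> norm (pprt x)"
  obtains f :: "'a \<Rightarrow>\<^sub>L real" where "dual_le 0 f" "\<And>x. f x \<le> p x" "\<And>x. \<bar>f x\<bar> \<le> norm x"
proof -
  obtain g where g: "linear g" "\<And>x. g x \<le> p x" using hahn_banach assms(1) by blast
  have le: "g x \<le> norm (pprt x)" for x using g(2) p order_trans by blast
  have bd: "\<bar>g x\<bar> \<le> norm x" for x
    using le[of x] le[of "- x"] norm_pprt_le[of x] norm_pprt_le[of "- x"] linear_neg[OF g(1), of x]
    by (simp add: abs_le_iff)
  have "bounded_linear g"
    using bd by (intro bounded_linear_intro[where K = 1])
      (auto simp: linear_add[OF g(1)] linear_scale[OF g(1)])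
  then have ap: "blinfun_apply (Blinfun g) = g" by (rule bounded_linear_Blinfun_apply)
  have "0 \<le> g x" if "0 \<le> x" for x
    using le[of "- x"] that linear_neg[OF g(1), of x] by simp
  then have "dual_le 0 (Blinfun g)" by (simp add: dual_le_def ap)
  then show ?thesis using g(2) bd by (intro that[of "Blinfun g"]) (auto simp: ap)
qed

lemma sublinear_norm_pprt: "sublinear (\<lambda>x::'a::banach_lattice. norm (pprt x))"
  unfolding sublinear_def
proof (intro conjI allI impI)
  fix x y :: 'a
  have "norm (pprt (x + y)) \<le> norm (pprt x + pprt y)"
    by (rule norm_mono_pos) (auto simp: pprt_add_le)
  also have "\<dots> \<le> norm (pprt x) + norm (pprt y)" by (rule norm_triangle_ineq)
  finally show "norm (pprt (x + y)) \<le> norm (pprt x) + norm (pprt y)" .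
qed (simp add: pprt_scaleR)

text \<open>Shifting the sublinear function \<open>y \<mapsto> \<parallel>y\<^sup>+\<parallel>\<close> at \<open>x\<close> before passing to a linear function forces
  \<open>f(- x) \<le> - \<parallel>x\<^sup>+\<parallel>\<close>.\<close>

lemma exists_positive_norming_functional:
  fixes x :: "'a::banach_lattice"
  obtains f :: "'a \<Rightarrow>\<^sub>L real"
  where "dual_le 0 f" "\<And>y. \<bar>f y\<bar> \<le> norm y" "f x = norm (pprt x)"
proof -
  obtain r where r: "sublinear r" "\<And>y. r y \<le> norm (pprt (y::'a))"
      "\<And>y. r y \<le> norm (pprt (y + x)) - norm (pprt x)"
    using sublinear_shift[OF sublinear_norm_pprt, of x] by blast
  obtain f :: "'a \<Rightarrow>\<^sub>L real" where f: "dual_le 0 f" "\<And>x. f x \<le> r x" "\<And>x. \<bar>f x\<bar> \<le> norm x"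
    using positive_functional_from_sublinear[OF r(1,2)] by blast
  have "f (- x) \<le> - norm (pprt x)" using f(2)[of "- x"] r(3)[of "- x"] by simp
  moreover have "f x \<le> norm (pprt x)" using f(2)[of x] r(2)[of x] by simp
  ultimately have "f x = norm (pprt x)" by (simp add: blinfun.minus_right)
  with f show ?thesis using that by blast
qed

lemma positive_if_functionals_nonneg:
  fixes x :: "'a::banach_lattice"
  assumes "\<And>f :: 'a \<Rightarrow>\<^sub>L real. dual_le 0 f \<Longrightarrow> 0 \<le> f x"
  shows "0 \<le> x"
proof -
  obtain f :: "'a \<Rightarrow>\<^sub>L real"
    where "dual_le 0 f" "\<And>y. \<bar>f y\<bar> \<le> norm y" "f (- x) = norm (pprt (- x))"
    using exists_positive_norming_functional by blast
  then have "norm (pprt (- x)) \<le> 0" using assms[of f] blinfun.minus_right[of f x] by linarith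
  then have "pprt (- x) = 0" by simp
  then have "- x \<le> 0" using le_zero_iff_zero_pprt by blast
  then show ?thesis by simp
qed

section \<open>Uniform boundedness\<close>

text \<open>Both uses of the Baire category theorem have this form.\<close>

lemma baire_ball:
  fixes C :: "nat \<Rightarrow> 'a::banach set"
  assumes "\<And>n. closed (C n)" "(\<Union>n. C n) = UNIV"
  obtains n x r where "0 < r" "cball x r \<subseteq> C n"
proof -
  have "\<exists>n. interior (C n) \<noteq> {}"
  proof (rule ccontr)
    assume "\<not> ?thesis"
    then have "Met_TC.mtopology interior_of \<Union>(range C) = {}"
      using assms(1)
      by (intro Met_TC.metric_Baire_category_alt) (auto simp: mcomplete_iff_complete complete_UNIV)
    then show False using assms(2) by simp
  qed
  then obtain n x where "x \<in> interior (C n)" by blast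
  then obtain r where "0 < r" "cball x r \<subseteq> C n" by (auto simp: mem_interior_cball)
  then show ?thesis using that by blast
qed

lemma powr_add_le:
  fixes a b p :: real
  assumes "0 \<le> p"
  shows "\<bar>a + b\<bar> powr p \<le> 2 powr p * (\<bar>a\<bar> powr p + \<bar>b\<bar> powr p)"
proof -
  have "\<bar>a + b\<bar> powr p \<le> (2 * max \<bar>a\<bar> \<bar>b\<bar>) powr p" using assms by (intro powr_mono2) auto
  also have "\<dots> = 2 powr p * max \<bar>a\<bar> \<bar>b\<bar> powr p" by (simp add: powr_mult)
  also have "max \<bar>a\<bar> \<bar>b\<bar> powr p \<le> \<bar>a\<bar> powr p + \<bar>b\<bar> powr p" by (simp add: max_def)
  finally show ?thesis by simp
qed

text \<open>The sums are bounded on some ball, and a multiple of any \<open>x\<close> is a difference of two elements of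
  that ball. The crude inequality above replaces the one of Minkowski.\<close>

lemma weak_star_p_summable_uniform:
  fixes f :: "nat \<Rightarrow> 'a::banach \<Rightarrow>\<^sub>L real"
  assumes "0 < p" "weak_star_p_summable p f"
  obtains C where "\<And>x K. norm x \<le> M \<Longrightarrow> (\<Sum>k<K. \<bar>f k x\<bar> powr p) \<le> C"
proof -
  define S where "S N = {x. \<forall>K. (\<Sum>k<K. \<bar>f k x\<bar> powr p) \<le> real N}" for N
  have cont: "continuous_on UNIV (\<lambda>x. \<Sum>k<K. \<bar>f k x\<bar> powr p)" for K
    using assms(1)
    by (intro continuous_on_sum continuous_on_powr' continuous_on_rabs continuous_on_const
        linear_continuous_on blinfun.bounded_linear_right) auto
  have "closed (S N)" for N
  proof -
    have "S N = (\<Inter>K. {x. (\<Sum>k<K. \<bar>f k x\<bar> powr p) \<le> real N})" by (auto simp: S_def)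
    then show ?thesis using cont by (auto intro!: closed_Collect_le)
  qed
  moreover have "x \<in> (\<Union>N. S N)" for x
  proof -
    have s: "summable (\<lambda>k. \<bar>f k x\<bar> powr p)"
      using assms(2) by (auto simp: weak_star_p_summable_def lp_seq_def)
    obtain N where "suminf (\<lambda>k. \<bar>f k x\<bar> powr p) \<le> real N" using real_arch_simple by blast
    moreover have "(\<Sum>k<K. \<bar>f k x\<bar> powr p) \<le> suminf (\<lambda>k. \<bar>f k x\<bar> powr p)" for K
      by (rule sum_le_suminf[OF s]) auto
    ultimately have "x \<in> S N" unfolding S_def using order_trans by blast
    then show ?thesis by blast
  qed
  then have "(\<Union>N. S N) = UNIV" by blast
  ultimately obtain N x0 r where r: "0 < r" "cball x0 r \<subseteq> S N" by (rule baire_ball)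
  define c where "c = r / (1 + \<bar>M\<bar>)"
  have c: "0 < c" using r by (simp add: c_def)
  show ?thesis
  proof (rule that)
    fix x :: 'a and K assume x: "norm x \<le> M"
    have "c * norm x \<le> c * (1 + \<bar>M\<bar>)" using c x by (intro mult_left_mono) auto
    moreover have "c * (1 + \<bar>M\<bar>) = r" by (simp add: c_def)
    ultimately have "norm (c *\<^sub>R x) \<le> r" using c by simp
    then have 1: "x0 + c *\<^sub>R x \<in> S N" "x0 \<in> S N" using r by (auto simp: dist_norm)
    have "c powr p * (\<Sum>k<K. \<bar>f k x\<bar> powr p) = (\<Sum>k<K. \<bar>f k (x0 + c *\<^sub>R x) + (- f k x0)\<bar> powr p)"
      using c by (simp add: blinfun.bilinear_simps sum_distrib_left abs_mult powr_mult)
    also have "\<dots> \<le> (\<Sum>k<K. 2 powr p * (\<bar>f k (x0 + c *\<^sub>R x)\<bar> powr p + \<bar>- f k x0\<bar> powr p))"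
      using assms(1) by (intro sum_mono powr_add_le) auto
    also have "\<dots> = 2 powr p * ((\<Sum>k<K. \<bar>f k (x0 + c *\<^sub>R x)\<bar> powr p) + (\<Sum>k<K. \<bar>f k x0\<bar> powr p))"
      by (simp add: sum_distrib_left[symmetric] sum.distrib)
    also have "\<dots> \<le> 2 powr p * (real N + real N)"
      using 1 by (intro mult_left_mono add_mono) (auto simp: S_def)
    finally show "(\<Sum>k<K. \<bar>f k x\<bar> powr p) \<le> 2 powr p * (real N + real N) / c powr p"
      using c by (simp add: field_simps)
  qed
qed

text \<open>The category argument takes place in \<open>E\<^sup>*\<close>; norming functionals then bound \<open>A\<close> itself.\<close>

lemma weakly_bounded_imp_bounded:
  fixes A :: "'a::banach_lattice set"
  assumes "\<And>f :: 'a \<Rightarrow>\<^sub>L real. \<exists>B. \<forall>x\<in>A. \<bar>f x\<bar> \<le> B"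
  shows "bounded A"
proof -
  define S where "S N = {f :: 'a \<Rightarrow>\<^sub>L real. \<forall>x\<in>A. \<bar>f x\<bar> \<le> real N}" for N
  have "closed (S N)" for N
  proof -
    have "S N = (\<Inter>x\<in>A. {f. \<bar>blinfun_apply f x\<bar> \<le> real N})" by (auto simp: S_def)
    then show ?thesis by (auto intro!: closed_INT closed_Collect_le continuous_intros)
  qed
  moreover have "f \<in> (\<Union>N. S N)" for f
  proof -
    obtain B where "\<forall>x\<in>A. \<bar>blinfun_apply f x\<bar> \<le> B" using assms by blast
    moreover obtain N where "B \<le> real N" using real_arch_simple by blast
    ultimately have "f \<in> S N" unfolding S_def using order_trans by blast
    then show ?thesis by blast
  qed
  then have "(\<Union>N. S N) = UNIV" by blast
  ultimately obtain N f0 r where r: "0 < r" "cball f0 r \<subseteq> S N" by (rule baire_ball)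
  have norm_le: "norm (pprt x) \<le> 2 * real N / r" if x: "x \<in> A \<or> - x \<in> A" for x
  proof -
    obtain f :: "'a \<Rightarrow>\<^sub>L real" where f: "\<And>y. \<bar>f y\<bar> \<le> norm y" "f x = norm (pprt x)"
      using exists_positive_norming_functional by blast
    have "norm f \<le> 1" using f(1) by (intro norm_blinfun_bound) auto
    then have "norm (r *\<^sub>R f) \<le> r" using r by simp
    then have 1: "f0 + r *\<^sub>R f \<in> S N" "f0 \<in> S N" using r by (auto simp: dist_norm)
    then have *: "\<bar>f0 y + r * f y\<bar> \<le> real N" "\<bar>f0 y\<bar> \<le> real N" if "y \<in> A" for y
      using that by (auto simp: S_def blinfun.bilinear_simps)
    have "r * f x \<le> 2 * real N"
      using x *[of x] *[of "- x"] by (auto simp: abs_le_iff blinfun.minus_right)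
    then show ?thesis using f(2) r by (simp add: field_simps)
  qed
  have "norm x \<le> 2 * real N / r + 2 * real N / r" if "x \<in> A" for x
  proof -
    have "norm x \<le> norm (pprt x) + norm (pprt (- x))"
      by (subst (1) pprt_split[of x]) (rule norm_triangle_ineq4)
    then show ?thesis using norm_le[of x] norm_le[of "- x"] that by simp
  qed
  then show ?thesis unfolding bounded_iff by blast
qed

section \<open>Disjoint sequences in the dual\<close>

text \<open>The supremum \<open>b\<close> of vectors that separate \<open>h\<close> from each \<open>g\<^sub>k\<close> separates \<open>h\<close> from all of them,
  since \<open>h\<close> of the supremum is at most the sum of its values, and \<open>x - b\<close> only decreases.\<close>

lemma disjoint_split_off_one:
  fixes g :: "nat \<Rightarrow> 'a::banach_lattice \<Rightarrow>\<^sub>L real"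
  assumes "\<And>k. k < K \<Longrightarrow> dual_le 0 (g k)" "dual_le 0 h"
    and "\<And>k. k < K \<Longrightarrow> dual_is_inf (g k) h 0" and "0 \<le> x" "0 < e"
  shows "\<exists>b. 0 \<le> b \<and> b \<le> x \<and> h b \<le> e \<and> (\<forall>k<K. g k (x - b) \<le> e)"
  using assms
proof (induction K arbitrary: e)
  case 0
  then show ?case by (intro exI[of _ 0]) (auto simp: blinfun.zero_right)
next
  case (Suc K)
  obtain b where b: "0 \<le> b" "b \<le> x" "h b \<le> e / 2" "\<And>k. k < K \<Longrightarrow> g k (x - b) \<le> e / 2"
    using Suc.IH[of "e / 2"] Suc.prems by auto
  obtain c where c: "0 \<le> c" "c \<le> x" "g K (x - c) + h c < e / 2"
    using dual_inf_zero_split[of "g K" h x "e / 2"] Suc.prems by auto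
  have pos: "0 \<le> g K (x - c)" "0 \<le> h c"
    using c Suc.prems by (auto intro: dual_posD)
  have "sup b c \<le> b + c" using b c by (auto intro: add_increasing add_increasing2)
  then have "h (sup b c) \<le> h b + h c"
    using dual_pos_mono[OF Suc.prems(2)] by (metis blinfun.add_right)
  moreover have "g k (x - sup b c) \<le> e" if "k < Suc K" for k
  proof -
    have "g k (x - sup b c) \<le> g k (x - b)" "g k (x - sup b c) \<le> g k (x - c)"
      using Suc.prems(1)[OF that] by (auto intro!: dual_pos_mono diff_left_mono)
    then show ?thesis
      using that b(4)[of k] c(3) pos Suc.prems(5) by (cases "k = K") auto
  qed
  moreover have "0 \<le> sup b c" "sup b c \<le> x" using b c by (auto intro: le_supI1)
  ultimately show ?case using b(3) c(3) pos by (intro exI[of _ "sup b c"]) auto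
qed

text \<open>By induction: the last functional keeps \<open>x - b\<close>, and the others divide \<open>b\<close> among themselves.\<close>

lemma disjoint_splitting:
  fixes g :: "nat \<Rightarrow> 'a::banach_lattice \<Rightarrow>\<^sub>L real"
  assumes "\<And>k. k < K \<Longrightarrow> dual_le 0 (g k)"
    and "\<And>j k. j < k \<Longrightarrow> k < K \<Longrightarrow> dual_is_inf (g j) (g k) 0" and "0 \<le> x" "0 < e"
  shows "\<exists>u. (\<forall>k<K. 0 \<le> u k \<and> g k (x - u k) \<le> e) \<and> (\<Sum>k<K. u k) \<le> x"
  using assms
proof (induction K arbitrary: x e)
  case (Suc K)
  obtain b where b: "0 \<le> b" "b \<le> x" "g K b \<le> e / 2" "\<And>k. k < K \<Longrightarrow> g k (x - b) \<le> e / 2"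
    using disjoint_split_off_one[of K g "g K" x "e / 2"] Suc.prems by auto
  have "\<exists>u. (\<forall>k<K. 0 \<le> u k \<and> g k (b - u k) \<le> e / 2) \<and> (\<Sum>k<K. u k) \<le> b"
    using Suc.IH[of b "e / 2"] Suc.prems b(1) by simp
  then obtain u where u: "\<And>k. k < K \<Longrightarrow> 0 \<le> u k" "\<And>k. k < K \<Longrightarrow> g k (b - u k) \<le> e / 2"
      "(\<Sum>k<K. u k) \<le> b"
    by blast
  have "g k (x - u k) \<le> e" if "k < K" for k
  proof -
    have "g k (x - u k) = g k (x - b) + g k (b - u k)" by (simp add: blinfun.bilinear_simps)
    then show ?thesis using b(4) u(2) that by fastforce
  qed
  then show ?case using b u Suc.prems(4)
    by (intro exI[of _ "u(K := x - b)"]) (auto simp: less_Suc_eq le_diff_eq algebra_simps)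
qed simp

text \<open>Up to an error, each \<open>g\<^sub>k\<close> acts only on its own piece \<open>u\<^sub>k\<close> of \<open>x\<close>, where it is bounded by \<open>f\<close>;
  and the pieces together do not exceed \<open>x\<close>.\<close>

lemma disjoint_sum_le:
  fixes g :: "nat \<Rightarrow> 'a::banach_lattice \<Rightarrow>\<^sub>L real"
  assumes "\<And>k. dual_le 0 (g k)" "\<And>k. dual_le (g k) f"
    and "\<And>j k. j < k \<Longrightarrow> dual_is_inf (g j) (g k) 0" and "0 \<le> x"
  shows "(\<Sum>k<K. g k x) \<le> f x"
proof (rule field_le_epsilon)
  fix e :: real assume e: "0 < e"
  define d where "d = e / (1 + real K)"
  have d: "0 < d" using e by (simp add: d_def)
  obtain u where u: "\<And>k. k < K \<Longrightarrow> 0 \<le> u k" "\<And>k. k < K \<Longrightarrow> g k (x - u k) \<le> d"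
      "(\<Sum>k<K. u k) \<le> x"
    using disjoint_splitting[of K g x d] assms d by blast
  have f: "dual_le 0 f" using assms(1,2) dual_le_trans by blast
  have "(\<Sum>k<K. g k x) \<le> (\<Sum>k<K. f (u k) + d)"
  proof (rule sum_mono)
    fix k assume "k \<in> {..<K}"
    then have "g k (u k) \<le> f (u k)" "g k (x - u k) \<le> d"
      using u dual_leD[OF assms(2)] by auto
    then show "g k x \<le> f (u k) + d" by (simp add: blinfun.diff_right)
  qed
  also have "\<dots> = f (\<Sum>k<K. u k) + real K * d" by (simp add: sum.distrib blinfun.sum_right)
  also have "\<dots> \<le> f x + real K * d" using dual_pos_mono[OF f u(3)] by simp
  also have "real K * d \<le> e" using e by (simp add: d_def field_simps)
  finally show "(\<Sum>k<K. g k x) \<le> f x + e" by simp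
qed

lemma dual_disjoint_modulus:
  assumes "dual_disjoint f g"
  shows "dual_is_inf (dual_pprt f + dual_pprt (- f)) (dual_pprt g + dual_pprt (- g)) 0"
  using assms dual_is_sup_modulus dual_is_sup_unique unfolding dual_disjoint_def by metis

lemma dual_disjoint_uminus: "dual_disjoint f g \<Longrightarrow> dual_disjoint (- f) (- g)"
  by (simp add: dual_disjoint_def dual_is_sup_def conj_commute conj_left_commute)

lemma lp_seq_comparison:
  assumes "b \<in> lp_seq p" "0 \<le> p" "\<And>n. \<bar>a n\<bar> \<le> \<bar>b n\<bar>"
  shows "a \<in> lp_seq p"
  unfolding lp_seq_def mem_Collect_eq
proof (rule summable_comparison_test')
  show "summable (\<lambda>n. \<bar>b n\<bar> powr p)" using assms by (simp add: lp_seq_def)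
  show "norm (\<bar>a n\<bar> powr p) \<le> \<bar>b n\<bar> powr p" if "n \<ge> 0" for n
    using assms by (auto intro: powr_mono2)
qed

lemma lp_seq_add:
  assumes "a \<in> lp_seq p" "b \<in> lp_seq p" "0 \<le> p"
  shows "(\<lambda>n. a n + b n) \<in> lp_seq p"
  unfolding lp_seq_def mem_Collect_eq
proof (rule summable_comparison_test')
  show "summable (\<lambda>n. 2 powr p * (\<bar>a n\<bar> powr p + \<bar>b n\<bar> powr p))"
    using assms by (intro summable_mult summable_add) (auto simp: lp_seq_def)
  show "norm (\<bar>a n + b n\<bar> powr p) \<le> 2 powr p * (\<bar>a n\<bar> powr p + \<bar>b n\<bar> powr p)" if "n \<ge> 0" for n
    using powr_add_le[OF assms(3), of "a n" "b n"] by simp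
qed

lemma lp_seqI_bounded_sums:
  assumes "\<And>K. (\<Sum>k<K. \<bar>a k\<bar> powr p) \<le> C"
  shows "a \<in> lp_seq p"
  unfolding lp_seq_def mem_Collect_eq
  by (rule bounded_imp_summable[where B = C]) (use assms[of "Suc _"] in \<open>auto simp: lessThan_Suc_atMost\<close>)

text \<open>By disjointness, vectors \<open>y\<^sub>k\<close> nearly attaining \<open>f\<^sub>k\<^sup>+(x)\<close> can be placed side by side under
  \<open>x\<close>. Their sum \<open>y\<close> then nearly attains all of \<open>f\<^sub>0\<^sup>+(x), \<dots>, f\<^bsub>K-1\<^esub>\<^sup>+(x)\<close> simultaneously, so the
  uniform bound for the sums of \<open>\<bar>f\<^sub>k(y)\<bar>\<^sup>p\<close> passes to the positive parts.\<close>

lemma disjoint_pprt_simultaneous: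
  fixes f :: "nat \<Rightarrow> 'a::banach_lattice \<Rightarrow>\<^sub>L real"
  assumes "disjoint_seq f" "0 \<le> x" "0 < e"
  obtains y where "0 \<le> y" "y \<le> x" "\<And>k. k < K \<Longrightarrow> dual_pprt (f k) x - 3 * e \<le> f k y"
proof -
  define g where "g k = dual_pprt (f k) + dual_pprt (- f k)" for k
  have gpos: "dual_le 0 (g k)" for k
    using dual_pprt_nonneg[of "f k"] dual_pprt_nonneg[of "- f k"]
    by (auto simp: g_def dual_le_def blinfun.bilinear_simps)
  have "dual_is_inf (g j) (g k) 0" if "j < k" for j k
    using assms(1) that unfolding g_def disjoint_seq_def
    by (intro dual_disjoint_modulus) auto
  then obtain u where u: "\<And>k. k < K \<Longrightarrow> 0 \<le> u k" "\<And>k. k < K \<Longrightarrow> g k (x - u k) \<le> e"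
      "(\<Sum>k<K. u k) \<le> x"
    using disjoint_splitting[of K g x e] gpos assms by blast
  have "\<forall>k\<in>{..<K}. \<exists>y. 0 \<le> y \<and> y \<le> u k \<and> dual_pprt (f k) (u k) - e < f k y"
    using dual_pprt_approx[OF _ assms(3)] u(1) by (metis lessThan_iff)
  then obtain y where y: "\<And>k. k < K \<Longrightarrow> 0 \<le> y k" "\<And>k. k < K \<Longrightarrow> y k \<le> u k"
      "\<And>k. k < K \<Longrightarrow> dual_pprt (f k) (u k) - e < f k (y k)"
    by (metis lessThan_iff)
  have le: "(\<Sum>k<K. y k) \<le> x"
    using sum_mono[of "{..<K}" y u] y(2) u(3) by (meson lessThan_iff order_trans)
  have "dual_pprt (f k) x - 3 * e \<le> f k (\<Sum>j<K. y j)" if k: "k < K" for k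
  proof -
    define r where "r = (\<Sum>j\<in>{..<K}-{k}. y j)"
    have r0: "0 \<le> r" unfolding r_def using y by (intro sum_nonneg) auto
    have "r \<le> (\<Sum>j\<in>{..<K}-{k}. u j)" unfolding r_def using y by (intro sum_mono) auto
    also have "\<dots> \<le> x - u k" using u(3) k by (simp add: sum_diff1 algebra_simps)
    finally have r1: "r \<le> x - u k" .
    have gr: "g k r \<le> e" using dual_pos_mono[OF gpos r1, of k] u(2)[OF k] by linarith
    have "- f k r \<le> dual_pprt (- f k) r" "0 \<le> dual_pprt (f k) r"
      using dual_leD[OF dual_pprt_ge_self[of "- f k"] r0] dual_posD[OF dual_pprt_nonneg r0]
      by (auto simp: blinfun.minus_left)
    then have 1: "- e \<le> f k r" using gr by (simp add: g_def blinfun.add_left)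
    have x': "0 \<le> x - u k" using r0 r1 by (rule order_trans)
    have "dual_pprt (f k) (x - u k) \<le> e"
      using u(2)[OF k] dual_posD[OF dual_pprt_nonneg[of "- f k"] x'] by (simp add: g_def blinfun.add_left)
    then have 2: "dual_pprt (f k) x - e \<le> dual_pprt (f k) (u k)" by (simp add: blinfun.diff_right)
    have "(\<Sum>j<K. y j) = y k + r" unfolding r_def using k by (simp add: sum.remove)
    then have "f k (\<Sum>j<K. y j) = f k (y k) + f k r" by (simp add: blinfun.add_right)
    then show ?thesis using 1 2 y(3)[OF k] by linarith
  qed
  moreover have "0 \<le> (\<Sum>k<K. y k)" using y by (intro sum_nonneg) auto
  ultimately show ?thesis using le that by blast
qed

lemma disjoint_pprt_summable:
  fixes f :: "nat \<Rightarrow> 'a::banach_lattice \<Rightarrow>\<^sub>L real"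
  assumes "disjoint_seq f" "weak_star_p_summable p f" "0 < p"
  shows "weak_star_p_summable p (\<lambda>k. dual_pprt (f k))"
  unfolding weak_star_p_summable_def
proof
  fix x :: 'a
  obtain C where C: "\<And>y K. norm y \<le> norm x \<Longrightarrow> (\<Sum>k<K. \<bar>f k y\<bar> powr p) \<le> C"
    using weak_star_p_summable_uniform[OF assms(3,2)] by blast
  have "(\<Sum>k<K. \<bar>dual_pprt (f k) \<bar>x\<bar>\<bar> powr p) \<le> C" for K
  proof (rule LIMSEQ_le_const2)
    let ?s = "\<lambda>n. \<Sum>k<K. (max 0 (dual_pprt (f k) \<bar>x\<bar> - 3 * inverse (real (Suc n)))) powr p"
    have "?s \<longlonglongrightarrow> (\<Sum>k<K. (max 0 (dual_pprt (f k) \<bar>x\<bar> - 3 * 0)) powr p)"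
      using assms(3)
      by (intro tendsto_sum tendsto_powr' tendsto_max tendsto_diff tendsto_mult tendsto_const
          LIMSEQ_inverse_real_of_nat) auto
    also have "(\<Sum>k<K. (max 0 (dual_pprt (f k) \<bar>x\<bar> - 3 * 0)) powr p)
        = (\<Sum>k<K. \<bar>dual_pprt (f k) \<bar>x\<bar>\<bar> powr p)"
      using dual_posD[OF dual_pprt_nonneg abs_ge_zero, of _ x]
      by (intro sum.cong) (auto simp: max_def)
    finally show "?s \<longlonglongrightarrow> (\<Sum>k<K. \<bar>dual_pprt (f k) \<bar>x\<bar>\<bar> powr p)" .
    have "?s n \<le> C" for n
    proof -
      obtain y where y: "0 \<le> y" "y \<le> \<bar>x\<bar>"
          "\<And>k. k < K \<Longrightarrow> dual_pprt (f k) \<bar>x\<bar> - 3 * inverse (real (Suc n)) \<le> f k y"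
        using disjoint_pprt_simultaneous[OF assms(1), of "\<bar>x\<bar>" "inverse (real (Suc n))" K] by auto
      have "norm y \<le> norm x" using norm_mono_pos[OF y(1,2)] by simp
      have "?s n \<le> (\<Sum>k<K. \<bar>f k y\<bar> powr p)"
        using y(3) assms(3) by (intro sum_mono powr_mono2) fastforce+
      also have "\<dots> \<le> C" using \<open>norm y \<le> norm x\<close> by (rule C)
      finally show ?thesis .
    qed
    then show "\<exists>N. \<forall>n\<ge>N. ?s n \<le> C" by blast
  qed
  then have "(\<lambda>k. dual_pprt (f k) \<bar>x\<bar>) \<in> lp_seq p" by (rule lp_seqI_bounded_sums)
  then show "(\<lambda>k. dual_pprt (f k) x) \<in> lp_seq p"
    using assms(3) dual_pos_abs_le[OF dual_pprt_nonneg]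
    by (elim lp_seq_comparison) (auto intro: order_trans[OF _ abs_ge_self])
qed

lemma positive_imp_almost_p_limited:
  fixes A :: "'a::banach_lattice set"
  assumes p: "1 \<le> p" and A: "positive_p_limited p A"
  shows "almost_p_limited p A"
  unfolding almost_p_limited_def
proof (intro allI impI, elim conjE)
  fix f :: "nat \<Rightarrow> 'a \<Rightarrow>\<^sub>L real"
  assume f: "disjoint_seq f" "weak_star_p_summable p f"
  have f': "disjoint_seq (\<lambda>k. - f k)" "weak_star_p_summable p (\<lambda>k. - f k)"
    using f by (auto simp: disjoint_seq_def dual_disjoint_uminus weak_star_p_summable_def
        lp_seq_def blinfun.minus_left)
  have "0 < p" using p by simp
  then have "weak_star_p_summable p (\<lambda>k. dual_pprt (f k))"
      "weak_star_p_summable p (\<lambda>k. dual_pprt (- f k))"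
    using disjoint_pprt_summable f f' by blast+
  then obtain a b where ab: "a \<in> lp_seq p" "b \<in> lp_seq p"
      "\<And>x n. x \<in> A \<Longrightarrow> \<bar>dual_pprt (f n) x\<bar> \<le> a n" "\<And>x n. x \<in> A \<Longrightarrow> \<bar>dual_pprt (- f n) x\<bar> \<le> b n"
    using A unfolding positive_p_limited_def positive_seq_def by (metis dual_pprt_nonneg)
  have "\<bar>f n x\<bar> \<le> a n + b n" if "x \<in> A" for x n
  proof -
    have "f n x = dual_pprt (f n) x - dual_pprt (- f n) x"
      by (simp add: dual_pprt_minus blinfun.diff_left)
    then show ?thesis using ab(3)[OF that, of n] ab(4)[OF that, of n] by linarith
  qed
  moreover have "(\<lambda>n. a n + b n) \<in> lp_seq p" using ab p by (intro lp_seq_add) auto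
  ultimately show "\<exists>a\<in>lp_seq p. \<forall>x\<in>A. \<forall>n. \<bar>f n x\<bar> \<le> a n"
    by (intro bexI[of _ "\<lambda>n. a n + b n"]) auto
qed

section \<open>Increasing sequences\<close>

text \<open>Along an increasing sequence the supremum of each \<open>f\<^sub>k(x\<^sub>n)\<close> is a limit, so the uniform
  bound on the sums of \<open>f\<^sub>k(x\<^sub>n)\<^sup>p\<close> passes to the suprema.\<close>

lemma increasing_positive_p_limited:
  fixes x :: "nat \<Rightarrow> 'a::banach_lattice"
  assumes p: "1 \<le> p" and x: "incseq x" "\<And>n. 0 \<le> x n" "bounded (range x)"
  shows "positive_p_limited p (range x)"
  unfolding positive_p_limited_def
proof (intro allI impI, elim conjE)
  fix f :: "nat \<Rightarrow> 'a \<Rightarrow>\<^sub>L real"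
  assume f: "positive_seq f" "weak_star_p_summable p f"
  obtain M where M: "\<And>n. norm (x n) \<le> M" using x(3) by (auto simp: bounded_iff)
  obtain C where C: "\<And>y K. norm y \<le> M \<Longrightarrow> (\<Sum>k<K. \<bar>f k y\<bar> powr p) \<le> C"
    using weak_star_p_summable_uniform[of p f M] f(2) p by auto
  have fpos: "dual_le 0 (f k)" for k using f(1) by (simp add: positive_seq_def)
  define a where "a k = (SUP n. f k (x n))" for k
  have bdd: "bdd_above (range (\<lambda>n. f k (x n)))" for k
    by (rule bdd_aboveI2[of _ _ "norm (f k) * M"])
      (meson M dual_le_norm mult_left_mono norm_ge_zero order_trans)
  have inc: "incseq (\<lambda>n. f k (x n))" for k
    using x(1) by (auto simp: incseq_def intro: dual_pos_mono[OF fpos])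
  have lim: "(\<lambda>n. f k (x n)) \<longlonglongrightarrow> a k" for k
    unfolding a_def by (rule LIMSEQ_incseq_SUP[OF bdd inc])
  have "(\<Sum>k<K. \<bar>a k\<bar> powr p) \<le> C" for K
  proof (rule LIMSEQ_le_const2)
    show "(\<lambda>n. \<Sum>k<K. \<bar>f k (x n)\<bar> powr p) \<longlonglongrightarrow> (\<Sum>k<K. \<bar>a k\<bar> powr p)"
      using p by (intro tendsto_sum tendsto_powr' tendsto_rabs lim tendsto_const) auto
    show "\<exists>N. \<forall>n\<ge>N. (\<Sum>k<K. \<bar>f k (x n)\<bar> powr p) \<le> C" using C M by blast
  qed
  then have "a \<in> lp_seq p" by (rule lp_seqI_bounded_sums)
  moreover have "\<bar>f n (x m)\<bar> \<le> a n" for m n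
    using cSUP_upper2[OF bdd, of m _ n] dual_posD[OF fpos x(2), of n m] by (simp add: a_def)
  ultimately show "\<exists>a\<in>lp_seq p. \<forall>y\<in>range x. \<forall>n. \<bar>f n y\<bar> \<le> a n" by blast
qed

lemma increasing_weakly_Cauchy:
  fixes x :: "nat \<Rightarrow> 'a::banach_lattice"
  assumes x: "incseq x" "bounded (range x)"
  shows "weakly_Cauchy x"
  unfolding weakly_Cauchy_def
proof
  fix f :: "'a \<Rightarrow>\<^sub>L real"
  obtain M where M: "\<And>n. norm (x n) \<le> M" using x(2) by (auto simp: bounded_iff)
  have pos: "convergent (\<lambda>n. g (x n))" if "dual_le 0 g" for g :: "'a \<Rightarrow>\<^sub>L real"
  proof -
    have "g (x n) \<le> norm g * M" for n
      by (meson M dual_le_norm mult_left_mono norm_ge_zero order_trans)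
    moreover have "\<forall>m n. m \<le> n \<longrightarrow> g (x m) \<le> g (x n)"
      using x(1) dual_pos_mono[OF that] by (auto simp: incseq_def)
    ultimately show ?thesis by (metis convergentI incseq_convergent incseq_def)
  qed
  have "convergent (\<lambda>n. dual_pprt f (x n) - dual_pprt (- f) (x n))"
    by (intro convergent_diff pos) auto
  moreover have "f y = dual_pprt f y - dual_pprt (- f) y" for y
    by (simp add: dual_pprt_minus blinfun.diff_left)
  ultimately show "Cauchy (\<lambda>n. f (x n))" by (simp add: convergent_eq_Cauchy convergent_Cauchy)
qed

text \<open>A decreasing sequence that is bounded away from zero in norm has a positive functional that
  is bounded away from zero on it: the Hahn-Banach theorem applies to the sublinear function
  below.\<close>

lemma decreasing_weakly_null_imp_null:
  fixes w :: "nat \<Rightarrow> 'a::banach_lattice"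
  assumes w: "decseq w" "\<And>n. 0 \<le> w n" and lim: "\<And>f :: 'a \<Rightarrow>\<^sub>L real. (\<lambda>n. f (w n)) \<longlonglongrightarrow> 0"
  shows "w \<longlonglongrightarrow> 0"
proof -
  have "\<exists>n. norm (w n) < d" if d: "0 < d" for d
  proof (rule ccontr)
    assume "\<not> ?thesis"
    then have ge_d: "d \<le> norm (w n)" for n by (simp add: not_less)
    define P where "P v = (\<lambda>(n, t). norm (pprt (v + t *\<^sub>R w n)) - t * d)" for v
    define I where "I = (UNIV :: nat set) \<times> {0::real..}"
    define p where "p v = (INF i\<in>I. P v i)" for v
    have tw: "0 \<le> t *\<^sub>R w n" if "0 \<le> t" for t n using that w(2) by (simp add: scaleR_nonneg_nonneg)
    have lower: "- norm v \<le> P v i" if "i \<in> I" for v i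
    proof -
      obtain n t where i: "i = (n, t)" "0 \<le> t" using \<open>i \<in> I\<close> by (auto simp: I_def)
      have "norm (t *\<^sub>R w n) - norm v \<le> norm (pprt (v + t *\<^sub>R w n))"
        using norm_pprt_diff_le[of "t *\<^sub>R w n" "v + t *\<^sub>R w n"] tw[OF i(2), of n]
          norm_triangle_ineq2[of "t *\<^sub>R w n" "pprt (v + t *\<^sub>R w n)"] by simp
      moreover have "t * d \<le> norm (t *\<^sub>R w n)" using i(2) ge_d[of n] by (simp add: mult_left_mono)
      ultimately show ?thesis by (simp add: P_def i)
    qed
    have bdd: "bdd_below (P v ` I)" for v using lower by (auto intro!: bdd_belowI2)
    have ne: "I \<noteq> {}" by (auto simp: I_def)
    have le: "p v \<le> P v (n, t)" if "0 \<le> t" for v n t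
      unfolding p_def using that by (intro cINF_lower[OF bdd]) (auto simp: I_def)
    have ge: "c \<le> p v" if "\<And>n t. 0 \<le> t \<Longrightarrow> c \<le> P v (n, t)" for c v
      unfolding p_def using that ne by (intro cINF_greatest) (auto simp: I_def)
    have sub: "P (v + v') (max n m, t + s) \<le> P v (n, t) + P v' (m, s)"
      if ts: "0 \<le> t" "0 \<le> s" for v v' n m t s
    proof -
      have dec: "w (max n m) \<le> w n" "w (max n m) \<le> w m" using w(1) by (auto simp: decseq_def)
      have "v + v' + (t + s) *\<^sub>R w (max n m)
          = (v + t *\<^sub>R w (max n m)) + (v' + s *\<^sub>R w (max n m))" by (simp add: algebra_simps)
      also have "\<dots> \<le> (v + t *\<^sub>R w n) + (v' + s *\<^sub>R w m)"
        using ts dec by (intro add_mono scaleR_left_mono) auto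
      finally have "pprt (v + v' + (t + s) *\<^sub>R w (max n m))
          \<le> pprt ((v + t *\<^sub>R w n) + (v' + s *\<^sub>R w m))" by (rule pprt_mono)
      also have "\<dots> \<le> pprt (v + t *\<^sub>R w n) + pprt (v' + s *\<^sub>R w m)" by (rule pprt_add_le)
      finally have "norm (pprt (v + v' + (t + s) *\<^sub>R w (max n m)))
          \<le> norm (pprt (v + t *\<^sub>R w n)) + norm (pprt (v' + s *\<^sub>R w m))"
        by (meson norm_mono_pos norm_triangle_ineq order_trans zero_le_pprt)
      then show ?thesis by (simp add: P_def algebra_simps)
    qed
    have "p (v + v') \<le> p v + p v'" for v v'
    proof -
      have "p (v + v') - P v' (m, s) \<le> p v" if "0 \<le> s" for m s
      proof (rule ge)
        fix n t assume "0 \<le> (t::real)"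
        then show "p (v + v') - P v' (m, s) \<le> P v (n, t)"
          using sub[of t s v v' n m] le[of "t + s" "v + v'" "max n m"] that by simp
      qed
      then have "p (v + v') - p v \<le> p v'" by (intro ge) (simp add: algebra_simps)
      then show ?thesis by simp
    qed
    moreover have "p (c *\<^sub>R v) = c * p v" if "0 \<le> c" for c v
    proof (cases "c = 0")
      case True
      have "p 0 = 0"
        using le[of 0 0] lower[of _ 0] by (intro antisym ge) (auto simp: P_def I_def)
      then show ?thesis using True by simp
    next
      case False
      with that have c: "0 < c" by simp
      have half: "b * p z \<le> p (b *\<^sub>R z)" if b: "0 < b" for b z
      proof (rule ge)
        fix n t assume t: "0 \<le> (t::real)"
        have "b *\<^sub>R z + t *\<^sub>R w n = b *\<^sub>R (z + (t / b) *\<^sub>R w n)" using b by (simp add: algebra_simps)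
        then have "P (b *\<^sub>R z) (n, t) = b * P z (n, t / b)"
          using b by (simp add: P_def pprt_scaleR right_diff_distrib)
        moreover have "b * p z \<le> b * P z (n, t / b)" using le b t by (intro mult_left_mono) auto
        ultimately show "b * p z \<le> P (b *\<^sub>R z) (n, t)" by simp
      qed
      have "(1 / c) * p (c *\<^sub>R v) \<le> p v" using half[of "1 / c" "c *\<^sub>R v"] c by simp
      then have "p (c *\<^sub>R v) \<le> c * p v" using c by (simp add: field_simps)
      with half[OF c, of v] show ?thesis by simp
    qed
    ultimately have "sublinear p" by (simp add: sublinear_def)
    moreover have "p v \<le> norm (pprt v)" for v using le[of 0 v] by (simp add: P_def)
    ultimately obtain f :: "'a \<Rightarrow>\<^sub>L real" where f: "\<And>x. f x \<le> p x"
      using positive_functional_from_sublinear by metis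
    have "d \<le> f (w n)" for n
      using f[of "- w n"] le[of 1 "- w n" n] by (simp add: P_def blinfun.minus_right)
    then have "d \<le> 0" using lim[of f] by (intro LIMSEQ_le_const) auto
    with d show False by simp
  qed
  moreover have "norm (w m) \<le> norm (w n)" if "n \<le> m" for m n
    using w that by (intro norm_mono_pos) (auto simp: decseq_def)
  ultimately show ?thesis
    unfolding LIMSEQ_iff by (metis diff_zero order_le_less_trans)
qed

section \<open>The weak topology\<close>

text \<open>The canonical embedding into the bidual. Inside the space of all functions on \<open>E\<^sup>*\<close>, pointwise
  convergence is weak* convergence.\<close>

definition evaluation :: "'a::real_normed_vector \<Rightarrow> ('a \<Rightarrow>\<^sub>L real) \<Rightarrow> real" where
  "evaluation x = (\<lambda>f. blinfun_apply f x)"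

lemma weak_topology_eq: "weak_topology = pullback_topology UNIV evaluation euclidean"
  by (simp add: weak_topology_def evaluation_def[abs_def])

lemma topspace_weak [simp]: "topspace weak_topology = UNIV"
  by (simp add: weak_topology_eq topspace_pullback_topology)

lemma continuous_evaluation: "continuous_map weak_topology euclidean evaluation"
  using continuous_map_pullback[OF continuous_map_id, of UNIV evaluation euclidean]
  by (simp add: weak_topology_eq)

lemma openin_weak_iff: "openin weak_topology U \<longleftrightarrow> (\<exists>V. open V \<and> U = evaluation -` V)"
  by (simp add: weak_topology_eq openin_pullback_topology)

lemma tendsto_function_iff:
  fixes u :: "nat \<Rightarrow> 'b \<Rightarrow> real"
  shows "u \<longlonglongrightarrow> l \<longleftrightarrow> (\<forall>i. (\<lambda>n. u n i) \<longlonglongrightarrow> l i)"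
proof -
  have "u \<longlonglongrightarrow> l \<longleftrightarrow> limitin (product_topology (\<lambda>i. euclidean) UNIV) u l sequentially"
    by (simp add: euclidean_product_topology)
  also have "\<dots> \<longleftrightarrow> (\<forall>i. (\<lambda>n. u n i) \<longlonglongrightarrow> l i)"
    by (subst limitin_componentwise) auto
  finally show ?thesis .
qed

lemma limitin_weak_iff:
  "limitin weak_topology x l sequentially \<longleftrightarrow> (\<forall>f :: 'a \<Rightarrow>\<^sub>L real. (\<lambda>n. f (x n)) \<longlonglongrightarrow> f l)"
  for x :: "nat \<Rightarrow> 'a::real_normed_vector" and l :: 'a
proof -
  have "limitin weak_topology x l sequentially \<longleftrightarrow> (\<lambda>n. evaluation (x n)) \<longlonglongrightarrow> evaluation l"
    by (auto simp: limitin_def openin_weak_iff tendsto_def)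
  then show ?thesis by (simp add: tendsto_function_iff) (simp add: evaluation_def)
qed

lemma compact_imp_closed_function:
  fixes K :: "('b \<Rightarrow> real) set"
  assumes "compact K"
  shows "closed K"
proof -
  have "Hausdorff_space (euclidean :: ('b \<Rightarrow> real) topology)"
    by (subst euclidean_product_topology[symmetric]) (simp add: Hausdorff_space_product_topology)
  then show ?thesis using compactin_imp_closedin[of euclidean K] assms by simp
qed

lemma rel_weakly_compact_imp_closure:
  assumes "rel_weakly_compact A"
  shows "closure (evaluation ` A) \<subseteq> range evaluation"
proof -
  have "compact (evaluation ` (weak_topology closure_of A))"
    using image_compactin[OF _ continuous_evaluation] assms
    by (auto simp: rel_weakly_compact_def)
  then have "closed (evaluation ` (weak_topology closure_of A))" by (rule compact_imp_closed_function)
  moreover have "A \<subseteq> weak_topology closure_of A" by (rule closure_of_subset) simp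
  ultimately have "closure (evaluation ` A) \<subseteq> evaluation ` (weak_topology closure_of A)"
    by (intro closure_minimal) auto
  then show ?thesis by blast
qed

text \<open>The theorem of Banach and Alaoglu, obtained from compactness of products of intervals.\<close>

lemma compact_closure_evaluation:
  fixes A :: "'a::real_normed_vector set"
  assumes "bounded A"
  shows "compact (closure (evaluation ` A))"
proof -
  obtain M where M: "\<And>x. x \<in> A \<Longrightarrow> norm x \<le> M" using assms by (auto simp: bounded_iff)
  define K where "K = PiE UNIV (\<lambda>f :: 'a \<Rightarrow>\<^sub>L real. {- (norm f * M)..norm f * M})"
  have "compactin (product_topology (\<lambda>_. euclidean) UNIV) K"
    unfolding K_def compactin_PiE by simp
  then have K: "compact K" by (simp add: euclidean_product_topology)
  have "evaluation x \<in> K" if "x \<in> A" for x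
  proof -
    have "\<bar>f x\<bar> \<le> norm f * M" for f :: "'a \<Rightarrow>\<^sub>L real"
      using norm_blinfun[of f x] mult_left_mono[OF M[OF that] norm_ge_zero, of f] by simp
    then show ?thesis by (auto simp: K_def evaluation_def abs_le_iff minus_le_iff)
  qed
  then have "closure (evaluation ` A) \<subseteq> K"
    using compact_imp_closed_function[OF K] by (intro closure_minimal) auto
  then have "K \<inter> closure (evaluation ` A) = closure (evaluation ` A)" by blast
  then show ?thesis using compact_Int_closed[OF K closed_closure] by metis
qed

text \<open>This is the form of weak compactness that the main argument uses: a bounded set is relatively
  weakly compact once the weak* limits of its elements in the bidual stay in \<open>E\<close>.\<close>

lemma rel_weakly_compactI:
  fixes A :: "'a::real_normed_vector set"
  assumes "bounded A" and sub: "closure (evaluation ` A) \<subseteq> range evaluation"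
  shows "rel_weakly_compact A"
proof -
  define S where "S = weak_topology closure_of A"
  have S: "x \<in> S" if "evaluation x \<in> closure (evaluation ` A)" for x
    unfolding S_def in_closure_of
  proof (intro conjI allI impI)
    fix T assume "x \<in> T \<and> openin weak_topology T"
    then obtain V where V: "open V" "T = evaluation -` V" "evaluation x \<in> V"
      by (auto simp: openin_weak_iff)
    then have "V \<inter> evaluation ` A \<noteq> {}"
      using that open_Int_closure_eq_empty[OF V(1)] by blast
    then show "\<exists>y. y \<in> A \<and> y \<in> T" using V(2) by auto
  qed simp
  have "evaluation ` S \<subseteq> closure (evaluation ` A)"
    using continuous_map_image_closure_subset[OF continuous_evaluation, of A]
    by (simp add: S_def)
  with S sub have img: "evaluation ` S = closure (evaluation ` A)" by blast
  have "compactin weak_topology S"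
    unfolding compactin_def
  proof (intro conjI allI impI)
    fix \<U> assume U: "Ball \<U> (openin weak_topology) \<and> S \<subseteq> \<Union> \<U>"
    then have "\<forall>T\<in>\<U>. \<exists>V. open V \<and> T = evaluation -` V" by (simp add: openin_weak_iff)
    then obtain V where V: "\<And>T. T \<in> \<U> \<Longrightarrow> open (V T)" "\<And>T. T \<in> \<U> \<Longrightarrow> T = evaluation -` V T"
      by metis
    have cover: "closure (evaluation ` A) \<subseteq> (\<Union>T\<in>\<U>. V T)"
    proof -
      have "evaluation y \<in> (\<Union>T\<in>\<U>. V T)" if y: "y \<in> S" for y
      proof -
        obtain T where "T \<in> \<U>" "y \<in> T" using U y by blast
        then show ?thesis using V(2)[of T] by blast
      qed
      then show ?thesis unfolding img[symmetric] by blast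
    qed
    obtain \<F> where F: "\<F> \<subseteq> \<U>" "finite \<F>" "closure (evaluation ` A) \<subseteq> (\<Union>T\<in>\<F>. V T)"
      using compactE_image[OF compact_closure_evaluation[OF assms(1)] V(1) cover] by metis
    have "S \<subseteq> \<Union>\<F>"
    proof
      fix y assume "y \<in> S"
      then have "evaluation y \<in> (\<Union>T\<in>\<F>. V T)" using F(3) img by blast
      then obtain T where "T \<in> \<F>" "evaluation y \<in> V T" by blast
      then show "y \<in> \<Union>\<F>" using V(2)[of T] F(1) by blast
    qed
    with F show "\<exists>\<F>. finite \<F> \<and> \<F> \<subseteq> \<U> \<and> S \<subseteq> \<Union> \<F>" by blast
  qed simp
  then show ?thesis by (simp add: rel_weakly_compact_def S_def)
qed

text \<open>The pointwise limit of a weakly Cauchy sequence lies in the weak* closure of its range.\<close>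

lemma weakly_Cauchy_rel_compact_imp_convergent:
  fixes x :: "nat \<Rightarrow> 'a::real_normed_vector"
  assumes "weakly_Cauchy x" "rel_weakly_compact (range x)"
  shows "weakly_convergent x"
proof -
  have "\<forall>f :: 'a \<Rightarrow>\<^sub>L real. \<exists>l. (\<lambda>n. f (x n)) \<longlonglongrightarrow> l"
    using assms(1) by (simp add: weakly_Cauchy_def convergent_eq_Cauchy[symmetric] convergent_def)
  from choice[OF this] obtain \<phi> :: "('a \<Rightarrow>\<^sub>L real) \<Rightarrow> real"
    where \<phi>: "\<And>f. (\<lambda>n. blinfun_apply f (x n)) \<longlonglongrightarrow> \<phi> f"
    by blast
  then have "(\<lambda>n. evaluation (x n)) \<longlonglongrightarrow> \<phi>" by (simp add: tendsto_function_iff evaluation_def)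
  then have "\<phi> \<in> closure (evaluation ` range x)"
    by (rule Lim_in_closed_set[OF closed_closure, rotated 2])
      (auto intro!: always_eventually closure_subset[THEN subsetD])
  then obtain l where "\<phi> = evaluation l" using rel_weakly_compact_imp_closure[OF assms(2)] by blast
  then show ?thesis
    using \<phi> by (auto simp: weakly_convergent_def limitin_weak_iff evaluation_def)
qed

lemma increasing_weakly_convergent_imp_convergent:
  fixes x :: "nat \<Rightarrow> 'a::banach_lattice"
  assumes x: "incseq x" and conv: "weakly_convergent x"
  shows "convergent x"
proof -
  obtain l where l: "\<And>f :: 'a \<Rightarrow>\<^sub>L real. (\<lambda>n. f (x n)) \<longlonglongrightarrow> f l"
    using conv by (auto simp: weakly_convergent_def limitin_weak_iff)
  define w where "w n = l - x n" for n
  have nonneg: "0 \<le> w n" for n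
  proof (rule positive_if_functionals_nonneg)
    fix f :: "'a \<Rightarrow>\<^sub>L real" assume "dual_le 0 f"
    then have "incseq (\<lambda>n. f (x n))" using x by (auto simp: incseq_def intro: dual_pos_mono)
    then have "f (x n) \<le> f l" using l incseq_le by blast
    then show "0 \<le> f (w n)" by (simp add: w_def blinfun.diff_right)
  qed
  have dec: "decseq w" using x by (auto simp: w_def decseq_def incseq_def)
  have null: "(\<lambda>n. f (w n)) \<longlonglongrightarrow> 0" for f :: "'a \<Rightarrow>\<^sub>L real"
    using tendsto_diff[OF tendsto_const l[of f], of "f l"] by (simp add: w_def blinfun.diff_right)
  have "w \<longlonglongrightarrow> 0" using dec nonneg null by (rule decreasing_weakly_null_imp_null)
  then have "(\<lambda>n. l - w n) \<longlonglongrightarrow> l - 0" by (intro tendsto_diff tendsto_const)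
  then show ?thesis by (auto simp: w_def convergent_def)
qed

section \<open>Order bounded disjoint sequences in the dual\<close>

text \<open>Pointwise limits replace norm limits in \<open>E\<^sup>*\<close>, where order bounded monotone sequences need not
  converge in norm.\<close>

lemma decreasing_dual_limit:
  fixes f :: "nat \<Rightarrow> 'a::banach_lattice \<Rightarrow>\<^sub>L real"
  assumes "\<And>n. dual_le 0 (f n)" "\<And>n. dual_le (f (Suc n)) (f n)"
  obtains g where "dual_le 0 g" "\<And>n. dual_le g (f n)" "\<And>x. (\<lambda>n. f n x) \<longlonglongrightarrow> blinfun_apply g x"
proof -
  have dec: "decseq (\<lambda>n. f n x)" if "0 \<le> x" for x
    using dual_leD[OF assms(2) that] by (rule decseq_SucI)
  have "convergent (\<lambda>n. f n x)" if "0 \<le> x" for x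
    using decseq_convergent[OF dec[OF that], of 0] dual_posD[OF assms(1) that]
    by (metis convergentI)
  then have "\<forall>x. \<exists>l. 0 \<le> x \<longrightarrow> (\<lambda>n. f n x) \<longlonglongrightarrow> l" by (auto simp: convergent_def)
  from choice[OF this] obtain q :: "'a \<Rightarrow> real"
    where q: "\<And>x. 0 \<le> x \<Longrightarrow> (\<lambda>n. f n x) \<longlonglongrightarrow> q x" by blast
  have q_le: "q x \<le> f n x" if "0 \<le> x" for x n
    using decseq_ge[OF dec[OF that] q[OF that]] .
  have q_nonneg: "0 \<le> q x" if "0 \<le> x" for x
    using q[OF that] dual_posD[OF assms(1) that] by (intro LIMSEQ_le_const) auto
  have "\<exists>g :: 'a \<Rightarrow>\<^sub>L real. \<forall>x\<ge>0. g x = q x"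
  proof (rule dual_from_cone)
    fix x y :: 'a assume xy: "0 \<le> x" "0 \<le> y"
    have "(\<lambda>n. f n x + f n y) \<longlonglongrightarrow> q x + q y" using xy by (intro tendsto_add q)
    then show "q (x + y) = q x + q y"
      using q[of "x + y"] xy LIMSEQ_unique by (simp add: blinfun.add_right)
  next
    fix x :: 'a assume x: "0 \<le> x"
    show "0 \<le> q x" using x by (rule q_nonneg)
    show "q x \<le> norm (f 0) * norm x" using q_le[OF x, of 0] dual_le_norm[of "f 0" x] by linarith
  qed
  then obtain g :: "'a \<Rightarrow>\<^sub>L real" where g: "\<And>x. 0 \<le> x \<Longrightarrow> g x = q x" by blast
  have "(\<lambda>n. f n x) \<longlonglongrightarrow> g x" for x
  proof -
    have "(\<lambda>n. f n (pprt x) - f n (pprt (- x))) \<longlonglongrightarrow> g (pprt x) - g (pprt (- x))"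
      by (intro tendsto_diff) (simp_all add: g q)
    then show ?thesis by (simp only: blinfun.diff_right[symmetric] pprt_split[symmetric])
  qed
  moreover have "dual_le 0 g" "dual_le g (f n)" for n
    using g q_nonneg q_le by (auto simp: dual_le_def)
  ultimately show ?thesis using that by blast
qed

text \<open>If later terms are small on the vectors chosen earlier, then order bounded functionals can be
  made disjoint at little cost: from \<open>g\<^sub>n\<close> remove a large multiple of everything that comes later,
  and a small multiple of the order bound \<open>f\<close>. For \<open>n < m\<close> the result for \<open>n\<close> lies below
  \<open>(f - c g\<^sub>m)\<^sup>+\<close> and the one for \<open>m\<close> below \<open>(g\<^sub>m - f / c)\<^sup>+\<close>, which are disjoint.\<close>

lemma disjointification:
  fixes g :: "nat \<Rightarrow> 'a::banach_lattice \<Rightarrow>\<^sub>L real"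
  assumes c: "0 < c" and g: "\<And>n. dual_le 0 (g n)" "\<And>n. dual_le (g n) f"
    and x: "\<And>n. 0 \<le> x n" and small: "\<And>n N. c * (\<Sum>m\<in>{n<..N}. g m (x n)) \<le> d"
  obtains k where "\<And>n. dual_le 0 (k n)" "\<And>n. dual_le (k n) f"
    "\<And>m n. m < n \<Longrightarrow> dual_is_inf (k m) (k n) 0"
    "\<And>n. g n (x n) - d - f (x n) / c \<le> blinfun_apply (k n) (x n)"
proof -
  define b where "b n N = g n - c *\<^sub>R (\<Sum>m\<in>{n<..N}. g m) - (1 / c) *\<^sub>R f" for n N
  define h where "h n N = dual_pprt (b n N)" for n N
  have f: "dual_le 0 f" using g dual_le_trans by blast
  have b_apply: "b n N y = g n y - c * (\<Sum>m\<in>{n<..N}. g m y) - f y / c" for n N y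
    by (simp add: b_def blinfun.bilinear_simps blinfun.sum_left)
  have sum0: "0 \<le> (\<Sum>m\<in>I. g m y)" if "0 \<le> y" for I y
    using dual_posD[OF g(1) that] by (intro sum_nonneg)
  have "dual_le (h n (Suc N)) (h n N)" for n N
    unfolding h_def
  proof (rule dual_pprt_mono, rule dual_leI)
    fix y :: 'a assume y: "0 \<le> y"
    have "(\<Sum>m\<in>{n<..N}. g m y) \<le> (\<Sum>m\<in>{n<..Suc N}. g m y)"
      using dual_posD[OF g(1) y] by (intro sum_mono2) auto
    then show "b n (Suc N) y \<le> b n N y" using c by (simp add: b_apply)
  qed
  then have "\<exists>k. dual_le 0 k \<and> (\<forall>N. dual_le k (h n N)) \<and> (\<forall>y. (\<lambda>N. h n N y) \<longlonglongrightarrow> k y)" for n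
    using decreasing_dual_limit[of "h n"] unfolding h_def by (metis dual_pprt_nonneg)
  then obtain k where k: "\<And>n. dual_le 0 (k n)" "\<And>n N. dual_le (k n) (h n N)"
      "\<And>n y. (\<lambda>N. h n N y) \<longlonglongrightarrow> blinfun_apply (k n) y"
    by metis
  have "dual_le (h n n) f" for n
    unfolding h_def using f
  proof (rule dual_pprt_minimal)
    show "dual_le (b n n) f"
    proof (rule dual_leI)
      fix y :: 'a assume y: "0 \<le> y"
      have "b n n y = g n y - f y / c" by (simp add: b_apply)
      then show "b n n y \<le> f y"
        using dual_leD[OF g(2) y, of n] divide_nonneg_pos[OF dual_posD[OF f y] c] by linarith
    qed
  qed
  then have "dual_le (k n) f" for n using k(2) dual_le_trans by blast
  moreover have "dual_is_inf (k n) (k m) 0" if nm: "n < m" for n m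
  proof (rule dual_disjoint_of_parts[where h = "f - c *\<^sub>R g m" and c = "1 / c"])
    have "dual_le (h n m) (dual_pprt (f - c *\<^sub>R g m))"
      unfolding h_def
    proof (rule dual_pprt_mono, rule dual_leI)
      fix y :: 'a assume y: "0 \<le> y"
      have "g m y \<le> (\<Sum>i\<in>{n<..m}. g i y)"
        using nm dual_posD[OF g(1) y] by (intro member_le_sum) auto
      then have "c * g m y \<le> c * (\<Sum>i\<in>{n<..m}. g i y)" using c by (intro mult_left_mono) auto
      then show "b n m y \<le> (f - c *\<^sub>R g m) y"
        using dual_leD[OF g(2) y, of n] divide_nonneg_pos[OF dual_posD[OF f y] c]
        by (simp add: b_apply blinfun.bilinear_simps)
    qed
    then show "dual_le (k n) (dual_pprt (f - c *\<^sub>R g m))" using k(2) dual_le_trans by blast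
    have "dual_le (h m m) ((1 / c) *\<^sub>R dual_pprt (- (f - c *\<^sub>R g m)))"
      unfolding h_def
    proof (rule dual_pprt_minimal)
      show "dual_le 0 ((1 / c) *\<^sub>R dual_pprt (- (f - c *\<^sub>R g m)))"
        using c dual_pprt_nonneg[of "- (f - c *\<^sub>R g m)"] by (simp add: dual_le_def blinfun.scaleR_left)
      show "dual_le (b m m) ((1 / c) *\<^sub>R dual_pprt (- (f - c *\<^sub>R g m)))"
      proof (rule dual_leI)
        fix y :: 'a assume "0 \<le> y"
        then have "(- (f - c *\<^sub>R g m)) y \<le> dual_pprt (- (f - c *\<^sub>R g m)) y"
          using dual_leD[OF dual_pprt_ge_self] by blast
        then have "(1 / c) * (- (f - c *\<^sub>R g m)) y \<le> (1 / c) * dual_pprt (- (f - c *\<^sub>R g m)) y"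
          using c by (intro mult_left_mono) auto
        moreover have "b m m y = (1 / c) * (- (f - c *\<^sub>R g m)) y"
          using c by (simp add: b_apply blinfun.bilinear_simps field_simps)
        ultimately show "b m m y \<le> ((1 / c) *\<^sub>R dual_pprt (- (f - c *\<^sub>R g m))) y"
          by (simp only: blinfun.scaleR_left real_scaleR_def)
      qed
    qed
    then show "dual_le (k m) ((1 / c) *\<^sub>R dual_pprt (- (f - c *\<^sub>R g m)))"
      using k(2) dual_le_trans by blast
  qed (use k(1) c in auto)
  moreover have "g n (x n) - d - f (x n) / c \<le> k n (x n)" for n
  proof (rule LIMSEQ_le_const[OF k(3)])
    have "g n (x n) - d - f (x n) / c \<le> h n N (x n)" for N
      using small[of n N] dual_leD[OF dual_pprt_ge_self[of "b n N"] x[of n]]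
      by (simp add: h_def b_apply)
    then show "\<exists>N0. \<forall>N\<ge>N0. g n (x n) - d - f (x n) / c \<le> h n N (x n)" by blast
  qed
  ultimately show ?thesis using that k(1) by blast
qed

text \<open>Uniform convergence to zero on \<open>B\<close>, expressed by sequences of elements of \<open>B\<close>. This is what the
  compactness argument extracts from almost \<open>p\<close>-limited sets.\<close>

definition null_on_order_bounded_disjoint :: "'a::banach_lattice set \<Rightarrow> bool" where
  "null_on_order_bounded_disjoint B \<longleftrightarrow>
     (\<forall>f k x. (\<forall>n. dual_le 0 (k n) \<and> dual_le (k n) f) \<and>
        (\<forall>m n. m < n \<longrightarrow> dual_is_inf (k m) (k n) 0) \<and> (\<forall>n. x n \<in> B) \<longrightarrow>
        (\<lambda>n::nat. blinfun_apply (k n) (x n) :: real) \<longlonglongrightarrow> 0)"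

lemma lp_seq_null:
  assumes "a \<in> lp_seq p" "0 < p"
  shows "a \<longlonglongrightarrow> 0"
proof -
  have "(\<lambda>n. \<bar>a n\<bar> powr p) \<longlonglongrightarrow> 0" using assms(1) by (simp add: lp_seq_def summable_LIMSEQ_zero)
  then have "(\<lambda>n. (\<bar>a n\<bar> powr p) powr (1 / p)) \<longlonglongrightarrow> 0"
    by (rule tendsto_zero_powrI[OF _ tendsto_const]) (use assms in auto)
  then show ?thesis using assms(2) by (simp add: powr_powr tendsto_rabs_zero_iff)
qed

lemma l1_imp_lp:
  assumes "1 \<le> p" "\<And>K. (\<Sum>k<K. \<bar>a k\<bar>) \<le> C"
  shows "a \<in> lp_seq p"
proof -
  have s: "summable (\<lambda>k. \<bar>a k\<bar>)"
    by (rule bounded_imp_summable[where B = C])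
      (use assms(2)[of "Suc _"] in \<open>auto simp: lessThan_Suc_atMost\<close>)
  then have "eventually (\<lambda>k. \<bar>a k\<bar> < 1) sequentially"
    using order_tendstoD(2)[OF summable_LIMSEQ_zero] by (metis zero_less_one)
  then have "eventually (\<lambda>k. norm (\<bar>a k\<bar> powr p) \<le> \<bar>a k\<bar>) sequentially"
  proof (rule eventually_mono)
    fix k assume "\<bar>a k\<bar> < 1"
    then show "norm (\<bar>a k\<bar> powr p) \<le> \<bar>a k\<bar>"
      using powr_le_one_le[of "\<bar>a k\<bar>" p] assms(1) by (cases "a k = 0") auto
  qed
  then show ?thesis unfolding lp_seq_def using s by (auto intro: summable_comparison_test_ev)
qed

text \<open>An order bounded disjoint sequence is weak* 1-summable, since its partial sums stay below the
  bound. To test positive parts \<open>x\<^sub>n\<^sup>+\<close> rather than \<open>x\<^sub>n\<close>, each functional is first restricted to the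
  band generated by \<open>x\<^sub>n\<^sup>+\<close>; this preserves disjointness.\<close>

lemma almost_p_limited_pprt_null:
  fixes A :: "'a::banach_lattice set"
  assumes p: "1 \<le> p" and A: "almost_p_limited p A"
  shows "null_on_order_bounded_disjoint (pprt ` A)"
  unfolding null_on_order_bounded_disjoint_def
proof (intro allI impI, elim conjE)
  fix f :: "'a \<Rightarrow>\<^sub>L real" and k :: "nat \<Rightarrow> 'a \<Rightarrow>\<^sub>L real" and x :: "nat \<Rightarrow> 'a"
  assume k: "\<forall>n. dual_le 0 (k n) \<and> dual_le (k n) f"
    and disj: "\<forall>m n. m < n \<longrightarrow> dual_is_inf (k m) (k n) 0" and x: "\<forall>n. x n \<in> pprt ` A"
  have "\<forall>n. \<exists>y. y \<in> A \<and> x n = pprt y" using x by blast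
  from choice[OF this] obtain y where y: "\<And>n. y n \<in> A" "\<And>n. x n = pprt (y n)" by blast
  have "\<exists>l. dual_le 0 l \<and> dual_le l (k n) \<and> l (y n) = k n (x n)" for n
    using dual_restrict_to_pprt[of "k n" "y n"] k y(2) by metis
  then obtain l where l: "\<And>n. dual_le 0 (l n)" "\<And>n. dual_le (l n) (k n)"
      "\<And>n. blinfun_apply (l n) (y n) = k n (x n)" by metis
  have inf: "dual_is_inf (l m) (l n) 0" if "m < n" for m n
    using that disj l k dual_is_inf_zero_mono[of "k m" "k n" "l m" "l n"] by blast
  have "dual_disjoint (l m) (l n)" if "m \<noteq> n" for m n
  proof (rule dual_disjoint_positive)
    show "dual_is_inf (l m) (l n) 0"
      using inf[of m n] inf[of n m] that by (auto simp: dual_is_inf_def neq_iff)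
  qed (simp_all add: l)
  then have "disjoint_seq l" by (simp add: disjoint_seq_def)
  moreover have "weak_star_p_summable p l"
    unfolding weak_star_p_summable_def
  proof
    fix z :: 'a
    have lf: "dual_le (l n) f" for n using l(2) k dual_le_trans by blast
    have "(\<Sum>n<K. \<bar>l n z\<bar>) \<le> (\<Sum>n<K. l n \<bar>z\<bar>)" for K
      using dual_pos_abs_le[OF l(1)] by (intro sum_mono)
    also have "(\<Sum>n<K. l n \<bar>z\<bar>) \<le> f \<bar>z\<bar>" for K
      using disjoint_sum_le[OF l(1) lf inf] by simp
    finally show "(\<lambda>n. l n z) \<in> lp_seq p" by (rule l1_imp_lp[OF p])
  qed
  ultimately obtain a where a: "a \<in> lp_seq p" "\<And>x n. x \<in> A \<Longrightarrow> \<bar>l n x\<bar> \<le> a n"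
    using A unfolding almost_p_limited_def by blast
  have "a \<longlonglongrightarrow> 0" using lp_seq_null[OF a(1)] p by simp
  then show "(\<lambda>n. k n (x n)) \<longlonglongrightarrow> 0"
    by (rule Lim_null_comparison[rotated]) (use a(2)[OF y(1)] in \<open>auto intro!: always_eventually simp flip: l(3)\<close>)
qed

lemma almost_p_limited_uminus:
  assumes "almost_p_limited p A"
  shows "almost_p_limited p (uminus ` A)"
  using assms by (simp add: almost_p_limited_def blinfun.minus_right)

lemma almost_p_limited_bounded:
  fixes A :: "'a::banach_lattice set"
  assumes "almost_p_limited p A"
  shows "bounded A"
proof (rule weakly_bounded_imp_bounded)
  fix f :: "'a \<Rightarrow>\<^sub>L real"
  \<comment> \<open>A single functional, followed by zeros, is a disjoint weak* \<open>p\<close>-summable sequence.\<close>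
  define g where "g n = (if n = 0 then f else 0)" for n :: nat
  have zero: "dual_is_sup 0 (- 0) (0 :: 'a \<Rightarrow>\<^sub>L real)" by (simp add: dual_is_sup_def)
  have "dual_is_inf u 0 0 \<and> dual_is_inf 0 u 0" if "dual_le 0 u" for u :: "'a \<Rightarrow>\<^sub>L real"
    using that by (simp add: dual_is_inf_def)
  moreover have "dual_le 0 (dual_pprt h + dual_pprt (- h))" for h :: "'a \<Rightarrow>\<^sub>L real"
    using dual_pprt_nonneg[of h] dual_pprt_nonneg[of "- h"]
    by (auto simp: dual_le_def blinfun.bilinear_simps)
  ultimately have "dual_disjoint h 0 \<and> dual_disjoint 0 h" for h :: "'a \<Rightarrow>\<^sub>L real"
    unfolding dual_disjoint_def using zero dual_is_sup_modulus by blast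
  then have "disjoint_seq g" by (simp add: disjoint_seq_def g_def)
  moreover have "weak_star_p_summable p g"
    unfolding weak_star_p_summable_def lp_seq_def g_def
  proof (intro allI CollectI summable_finite[of "{0}"])
  qed auto
  ultimately obtain a where "\<And>x n. x \<in> A \<Longrightarrow> \<bar>g n x\<bar> \<le> a n"
    using assms unfolding almost_p_limited_def by blast
  from this[of _ 0] show "\<exists>B. \<forall>x\<in>A. \<bar>f x\<bar> \<le> B" by (auto simp: g_def)
qed

section \<open>Weak* limits in the bidual\<close>

text \<open>Linearity, positivity and bounds pass to weak* limits, being closed conditions.\<close>

lemma closure_evaluation_property:
  assumes "\<phi> \<in> closure (evaluation ` B)" "closed {\<psi>. P \<psi>}" "\<And>x. x \<in> B \<Longrightarrow> P (evaluation x)"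
  shows "P \<phi>"
proof -
  have "closure (evaluation ` B) \<subseteq> {\<psi>. P \<psi>}" using assms by (intro closure_minimal) auto
  with assms(1) show ?thesis by blast
qed

context
  fixes B :: "'a::banach_lattice set" and \<phi> :: "('a \<Rightarrow>\<^sub>L real) \<Rightarrow> real"
  assumes \<phi>: "\<phi> \<in> closure (evaluation ` B)"
begin

lemma closure_evaluation_add: "\<phi> (f + g) = \<phi> f + \<phi> g"
  by (rule closure_evaluation_property[OF \<phi>])
    (auto intro!: closed_Collect_eq continuous_on_add simp: evaluation_def blinfun.add_left)

lemma closure_evaluation_scaleR: "\<phi> (c *\<^sub>R f) = c * \<phi> f"
  by (rule closure_evaluation_property[OF \<phi>])
    (auto intro!: closed_Collect_eq continuous_on_mult continuous_on_const
      simp: evaluation_def blinfun.scaleR_left)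

lemma closure_evaluation_diff: "\<phi> (f - g) = \<phi> f - \<phi> g"
  using closure_evaluation_add[of "f - g" g] by simp

lemma closure_evaluation_le:
  assumes "\<And>x. x \<in> B \<Longrightarrow> blinfun_apply f x \<le> c"
  shows "\<phi> f \<le> c"
  using assms by (intro closure_evaluation_property[OF \<phi>, of "\<lambda>\<psi>. \<psi> f \<le> c"])
    (auto intro!: closed_Collect_le continuous_on_const simp: evaluation_def)

lemma closure_evaluation_nonneg:
  assumes "\<And>x. x \<in> B \<Longrightarrow> 0 \<le> x" "dual_le 0 f"
  shows "0 \<le> \<phi> f"
  using assms dual_posD[OF assms(2)]
  by (intro closure_evaluation_property[OF \<phi>, of "\<lambda>\<psi>. 0 \<le> \<psi> f"])
    (auto intro!: closed_Collect_le continuous_on_const simp: evaluation_def)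

text \<open>On each order interval \<open>[0, f]\<close> the limit \<open>\<phi>\<close> is absolutely continuous with respect to some
  element of \<open>E\<close>. Otherwise one chooses successively \<open>g\<^sub>n \<in> [0, f]\<close> that are tiny on the
  vectors chosen before, with \<open>\<phi>(g\<^sub>n)\<close> and therefore some \<open>g\<^sub>n(x\<^sub>n)\<close> large. After disjointification
  this contradicts the assumption on \<open>B\<close>.\<close>

lemma closure_evaluation_absolutely_continuous:
  assumes null: "null_on_order_bounded_disjoint B" and pos: "\<And>x. x \<in> B \<Longrightarrow> 0 \<le> x"
    and bdd: "bounded B" and f: "dual_le 0 f" and e: "0 < e"
  shows "\<exists>u d. 0 \<le> u \<and> 0 < d \<and>
    (\<forall>g. dual_le 0 g \<and> dual_le g f \<and> blinfun_apply g u \<le> d \<longrightarrow> \<phi> g \<le> e)"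
proof (rule ccontr)
  assume neg: "\<not> ?thesis"
  obtain M where M: "\<And>x. x \<in> B \<Longrightarrow> norm x \<le> M" using bdd by (auto simp: bounded_iff)
  define F where "F = 1 + norm f * \<bar>M\<bar>"
  have F: "0 < F" by (simp add: F_def add_pos_nonneg)
  have fF: "f x \<le> F" if "x \<in> B" for x
  proof -
    have "f x \<le> norm f * norm x" by (rule dual_le_norm)
    also have "\<dots> \<le> norm f * \<bar>M\<bar>" using M[OF that] by (intro mult_left_mono) auto
    finally show ?thesis by (simp add: F_def)
  qed
  \<comment> \<open>The disjointification loses \<open>e/4\<close> through the later terms and \<open>F/c = e/4\<close> through \<open>f/c\<close>.\<close>
  define c where "c = 4 * F / e"
  define d where "d n = e / (4 * c) * (1/2) ^ Suc n" for n
  have c: "0 < c" and d: "0 < d n" for n using F e by (auto simp: c_def d_def)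
  define good where "good n u = (\<lambda>(g, x). x \<in> B \<and> dual_le 0 g \<and> dual_le g f \<and>
    blinfun_apply g u \<le> d n \<and> e < blinfun_apply g x)" for n u
  have "\<exists>gx. good n u gx" if "0 \<le> u" for n u
  proof -
    have "\<not> (\<forall>g. dual_le 0 g \<and> dual_le g f \<and> blinfun_apply g u \<le> d n \<longrightarrow> \<phi> g \<le> e)"
      using neg \<open>0 \<le> u\<close> d[of n] by blast
    then obtain g where g: "dual_le 0 g" "dual_le g f" "blinfun_apply g u \<le> d n" "\<not> \<phi> g \<le> e"
      by blast
    then obtain x where "x \<in> B" "e < blinfun_apply g x"
      using closure_evaluation_le[of g e] by (meson not_less)
    with g show ?thesis by (intro exI[of _ "(g, x)"]) (simp add: good_def)
  qed
  then have good: "0 \<le> u \<Longrightarrow> good n u (SOME gx. good n u gx)" for n u by (meson someI_ex)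
  define G where "G n u = fst (SOME gx. good n u gx)" for n u
  define X where "X n u = snd (SOME gx. good n u gx)" for n u
  have GX: "X n u \<in> B" "dual_le 0 (G n u)" "dual_le (G n u) f" "G n u u \<le> d n" "e < G n u (X n u)"
    if "0 \<le> u" for n u
  proof -
    have "good n u (G n u, X n u)" using good[OF that, of n] by (simp add: G_def X_def)
    then show "X n u \<in> B" "dual_le 0 (G n u)" "dual_le (G n u) f" "G n u u \<le> d n"
        "e < G n u (X n u)" by (auto simp: good_def)
  qed
  define U where "U = rec_nat (0::'a) (\<lambda>n u. u + X n u)"
  have U_Suc: "U (Suc n) = U n + X n (U n)" for n by (simp add: U_def)
  have U: "0 \<le> U n" for n
  proof (induction n)
    case (Suc n)
    then show ?case using GX(1)[OF Suc] pos by (simp add: U_Suc add_nonneg_nonneg)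
  qed (simp add: U_def)
  define g where "g n = G n (U n)" for n
  define x where "x n = X n (U n)" for n
  have xB: "x n \<in> B" for n using GX(1) U by (simp add: x_def)
  have x0: "0 \<le> x n" for n using pos xB by blast
  have "incseq U" using x0 by (intro incseq_SucI) (simp add: U_Suc x_def)
  then have xU: "x i \<le> U m" if "i < m" for i m
  proof -
    have "x i \<le> U (Suc i)" using U by (simp add: U_Suc x_def)
    also have "\<dots> \<le> U m" using \<open>incseq U\<close> that by (auto simp: incseq_def)
    finally show ?thesis .
  qed
  have g: "dual_le 0 (g n)" "dual_le (g n) f" "e < g n (x n)" for n
    using GX U by (auto simp: g_def x_def)
  have "c * (\<Sum>m\<in>{n<..N}. g m (x n)) \<le> e / 4" for n N
  proof -
    have "(\<Sum>m\<in>{n<..N}. g m (x n)) \<le> (\<Sum>m\<in>{n<..N}. d m)"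
    proof (rule sum_mono)
      fix m assume "m \<in> {n<..N}"
      then have "g m (x n) \<le> g m (U m)" using xU by (intro dual_pos_mono[OF g(1)]) auto
      also have "\<dots> \<le> d m" using GX(4) U by (simp add: g_def)
      finally show "g m (x n) \<le> d m" .
    qed
    also have "\<dots> \<le> (\<Sum>m. d m)"
    proof (rule sum_le_suminf)
      show "summable d" unfolding d_def by (intro summable_mult) (rule sums_summable[OF power_half_series])
    qed (use d less_imp_le in auto)
    also have "\<dots> = e / (4 * c)"
      unfolding d_def using sums_mult[OF power_half_series, of "e / (4 * c)"] by (simp add: sums_iff)
    finally show ?thesis using c by (simp add: field_simps)
  qed
  from disjointification[OF c g(1,2) x0 this] obtain k
    where k: "\<And>n. dual_le 0 (k n)" "\<And>n. dual_le (k n) f" "\<And>m n. m < n \<Longrightarrow> dual_is_inf (k m) (k n) 0"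
      "\<And>n. g n (x n) - e / 4 - f (x n) / c \<le> blinfun_apply (k n) (x n)" by blast
  have large: "e / 2 \<le> k n (x n)" for n
  proof -
    have "f (x n) / c \<le> F / c" using fF[OF xB] c by (simp add: divide_right_mono)
    also have "F / c = e / 4" using F e by (simp add: c_def)
    finally show ?thesis using k(4)[of n] g(3)[of n] by simp
  qed
  have "(\<lambda>n. k n (x n)) \<longlonglongrightarrow> 0"
    using null k(1-3) xB unfolding null_on_order_bounded_disjoint_def by blast
  then have "e / 2 \<le> 0" using large by (intro LIMSEQ_le_const) auto
  with e show False by simp
qed

end

section \<open>Suprema in a KB-space\<close>

lemma kb_spaceD:
  fixes x :: "nat \<Rightarrow> 'a::banach_lattice"
  assumes "kb_space TYPE('a)" "incseq x" "\<And>n. 0 \<le> x n" "\<And>n. norm (x n) \<le> M"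
  shows "convergent x"
proof -
  have "bounded (range x)" using assms(4) by (auto simp: bounded_iff)
  then show ?thesis using assms unfolding kb_space_def by blast
qed

text \<open>An upward directed norm bounded set is norm Cauchy upwards, as otherwise it would contain an
  increasing sequence that does not converge.\<close>

lemma kb_space_greatest:
  fixes D :: "'a::banach_lattice set"
  assumes kb: "kb_space TYPE('a)" and ne: "D \<noteq> {}" and pos: "\<And>y. y \<in> D \<Longrightarrow> 0 \<le> y"
    and sup: "\<And>y z. y \<in> D \<Longrightarrow> z \<in> D \<Longrightarrow> sup y z \<in> D" and "closed D" "bounded D"
  obtains m where "m \<in> D" "\<And>y. y \<in> D \<Longrightarrow> y \<le> m"
proof -
  obtain M where M: "\<And>y. y \<in> D \<Longrightarrow> norm y \<le> M" using \<open>bounded D\<close> by (auto simp: bounded_iff)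
  have conv: "convergent s" if "incseq s" "\<And>n. s n \<in> D" for s
    using kb_spaceD[OF kb that(1) pos M] that(2) by blast
  have cauchy: "\<exists>y\<in>D. \<forall>z\<in>D. y \<le> z \<longrightarrow> norm (z - y) \<le> e" if e: "0 < e" for e
  proof (rule ccontr)
    assume "\<not> ?thesis"
    then have "\<forall>y\<in>D. \<exists>z. z \<in> D \<and> y \<le> z \<and> e < norm (z - y)" by (auto simp: not_le)
    then obtain F where F: "\<And>y. y \<in> D \<Longrightarrow> F y \<in> D" "\<And>y. y \<in> D \<Longrightarrow> y \<le> F y"
        "\<And>y. y \<in> D \<Longrightarrow> e < norm (F y - y)" by metis
    obtain y0 where y0: "y0 \<in> D" using ne by blast
    define s where "s n = (F ^^ n) y0" for n
    have sD: "s n \<in> D" for n by (induction n) (auto simp: s_def y0 F(1))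
    have "incseq s" using F(2)[OF sD] by (intro incseq_SucI) (simp add: s_def)
    then have "convergent s" using sD by (rule conv)
    then obtain l where l: "s \<longlonglongrightarrow> l" by (auto simp: convergent_def)
    have "(\<lambda>n. norm (s (Suc n) - s n)) \<longlonglongrightarrow> norm (l - l)"
      using l LIMSEQ_Suc[OF l] by (intro tendsto_norm tendsto_diff)
    moreover have "e \<le> norm (s (Suc n) - s n)" for n
      using F(3)[OF sD, of n] by (simp add: s_def)
    ultimately have "e \<le> norm (l - l)" by (intro LIMSEQ_le_const) auto
    with e show False by simp
  qed
  have "\<exists>y\<in>D. \<forall>z\<in>D. y \<le> z \<longrightarrow> norm (z - y) \<le> inverse (real (Suc n))" for n
    by (rule cauchy) simp
  then obtain Y where Y: "\<And>n. Y n \<in> D"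
      "\<And>n z. z \<in> D \<Longrightarrow> Y n \<le> z \<Longrightarrow> norm (z - Y n) \<le> inverse (real (Suc n))" by metis
  define s where "s = rec_nat (Y 0) (\<lambda>n y. sup y (Y (Suc n)))"
  have s_Suc: "s (Suc n) = sup (s n) (Y (Suc n))" for n by (simp add: s_def)
  have sD: "s n \<in> D" for n
    by (induction n) (auto simp: s_Suc sup Y(1), simp add: s_def Y(1))
  have Ys: "Y n \<le> s n" for n by (cases n) (simp_all add: s_Suc, simp add: s_def)
  have "incseq s" by (intro incseq_SucI) (simp add: s_Suc)
  then have "convergent s" using sD by (rule conv)
  then obtain m where m: "s \<longlonglongrightarrow> m" by (auto simp: convergent_def)
  have "y \<le> m" if y: "y \<in> D" for y
  proof -
    have "norm (pprt (y - s n)) \<le> inverse (real (Suc n))" for n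
    proof -
      have eq: "pprt (y - s n) = sup (s n) y - s n" by (simp add: sup_eq_add_pprt)
      have "norm (sup (s n) y - s n) \<le> norm (sup (s n) y - Y n)"
        using Ys by (intro norm_mono_pos diff_left_mono) auto
      also have "\<dots> \<le> inverse (real (Suc n))"
        using sup[OF sD y] Ys by (intro Y(2)) (auto intro: le_supI1)
      finally show ?thesis by (simp only: eq)
    qed
    moreover have "(\<lambda>n. norm (pprt (y - s n))) \<longlonglongrightarrow> norm (pprt (y - m))"
      by (intro tendsto_norm tendsto_pprt tendsto_diff tendsto_const m)
    ultimately have "norm (pprt (y - m)) \<le> 0"
      by (intro LIMSEQ_le[OF _ LIMSEQ_inverse_real_of_nat]) auto
    then have "pprt (y - m) = 0" by simp
    then show ?thesis using le_zero_iff_zero_pprt[of "y - m"] by simp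
  qed
  moreover have "m \<in> D" using \<open>closed D\<close> sD m by (rule closed_sequentially)
  ultimately show ?thesis using that by blast
qed

text \<open>If \<open>f\<close> is strictly positive on \<open>[0, z]\<close> then every positive \<open>g\<close> is absolutely continuous with
  respect to \<open>f\<close> there. Witnesses \<open>w\<^sub>n\<close> to the contrary have \<open>f(w\<^sub>n)\<close> summable, so their tail suprema
  decrease to an element on which \<open>f\<close> vanishes, while \<open>g\<close> does not.\<close>

lemma kb_space_truncation:
  fixes f g :: "'a::banach_lattice \<Rightarrow>\<^sub>L real"
  assumes kb: "kb_space TYPE('a)" and f: "dual_le 0 f" and g: "dual_le 0 g" and z: "0 \<le> z"
    and strict: "\<And>w. 0 \<le> w \<Longrightarrow> w \<le> z \<Longrightarrow> f w = 0 \<Longrightarrow> w = 0" and e: "0 < e"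
  shows "\<exists>n::nat. dual_pprt (g - real n *\<^sub>R f) z \<le> e"
proof (rule ccontr)
  assume "\<not> ?thesis"
  then have large: "e < dual_pprt (g - real n *\<^sub>R f) z" for n by (simp add: not_le)
  have "\<exists>w. 0 \<le> w \<and> w \<le> z \<and> e < g w - 2 ^ n * f w" for n
  proof -
    obtain w where "0 \<le> w" "w \<le> z" "e < (g - real (2 ^ n) *\<^sub>R f) w"
      using dual_pprt_approx[OF z, of "dual_pprt (g - real (2 ^ n) *\<^sub>R f) z - e"
          "g - real (2 ^ n) *\<^sub>R f"] large[of "2 ^ n"] by auto
    then show ?thesis by (intro exI[of _ w]) (simp add: blinfun.bilinear_simps)
  qed
  then obtain w where w: "\<And>n. 0 \<le> w n" "\<And>n. w n \<le> z" "\<And>n. e < g (w n) - 2 ^ n * f (w n)"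
    by metis
  have fw0: "0 \<le> f (w n)" for n using dual_posD[OF f w(1)] .
  have gw: "e < g (w n)" for n using w(3)[of n] fw0[of n] by (smt (verit) zero_le_power mult_nonneg_nonneg)
  have fw: "f (w n) \<le> g z * (1/2) ^ n" for n
  proof -
    have "2 ^ n * f (w n) \<le> g z" using w(3)[of n] e dual_pos_mono[OF g w(2), of n] by linarith
    then show ?thesis by (simp add: field_simps)
  qed
  have gz: "0 \<le> g z" using dual_posD[OF g z] .
  define V where "V k = rec_nat (w k) (\<lambda>m v. sup v (w (k + Suc m)))" for k
  have V0: "V k 0 = w k" and VS: "V k (Suc m) = sup (V k m) (w (k + Suc m))" for k m
    by (simp_all add: V_def)
  have Vpos: "0 \<le> V k m" for k m by (induction m) (auto simp: V0 VS w(1) intro: le_supI1)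
  have Vz: "V k m \<le> z" for k m by (induction m) (auto simp: V0 VS w(2))
  have inc: "incseq (V k)" for k by (intro incseq_SucI) (simp add: VS)
  have shift: "V (Suc k) m \<le> V k (Suc m)" for k m
  proof (induction m)
    case (Suc m)
    then show ?case by (auto simp: VS intro: le_supI1)
  qed (simp add: V0 VS)
  have fV: "f (V k m) \<le> g z * (1/2) ^ k * (2 - (1/2) ^ m)" for k m
  proof (induction m)
    case 0
    then show ?case using fw[of k] by (simp add: V0)
  next
    case (Suc m)
    have "V k (Suc m) \<le> V k m + w (k + Suc m)"
      unfolding VS using Vpos w(1) by (auto intro: add_increasing add_increasing2)
    then have "f (V k (Suc m)) \<le> f (V k m) + f (w (k + Suc m))"
      using dual_pos_mono[OF f] by (metis blinfun.add_right)
    also have "\<dots> \<le> g z * (1/2) ^ k * (2 - (1/2) ^ m) + g z * (1/2) ^ (k + Suc m)"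
      using Suc fw by (rule add_mono)
    also have "\<dots> = g z * (1/2) ^ k * (2 - (1/2) ^ Suc m)"
      by (simp add: power_add algebra_simps)
    finally show ?case .
  qed
  have "convergent (V k)" for k
    using kb_spaceD[OF kb inc Vpos norm_mono_pos[OF Vpos Vz]] .
  then have "\<forall>k. \<exists>l. V k \<longlonglongrightarrow> l" by (simp add: convergent_def)
  from choice[OF this] obtain v where v: "\<And>k. V k \<longlonglongrightarrow> v k" by blast
  have vpos: "0 \<le> v k" for k using tendsto_nonneg[OF v] Vpos by blast
  have vz: "v k \<le> z" for k using tendsto_le_lattice[OF v tendsto_const] Vz by blast
  have wv: "w k \<le> v k" for k
  proof (rule tendsto_le_lattice[OF tendsto_const v])
    show "w k \<le> V k m" if "m \<ge> 0" for m
      using incseqD[OF inc, of 0 m k] by (simp add: V0)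
  qed
  have dec: "v (Suc k) \<le> v k" for k
    by (rule tendsto_le_lattice[OF v LIMSEQ_Suc[OF v]]) (rule shift)
  have fv: "f (v k) \<le> g z * (1/2) ^ k * 2" for k
  proof (rule LIMSEQ_le_const2)
    show "(\<lambda>m. f (V k m)) \<longlonglongrightarrow> f (v k)" by (intro blinfun.tendsto tendsto_const v)
    have "f (V k m) \<le> g z * (1/2) ^ k * 2" for m
      using fV[of k m] gz mult_left_mono[of "2 - (1/2) ^ m" 2 "g z * (1/2) ^ k"] by simp
    then show "\<exists>N. \<forall>m\<ge>N. f (V k m) \<le> g z * (1/2) ^ k * 2" by blast
  qed
  have "convergent (\<lambda>k. z - v k)"
    using dec vz vpos
    by (intro kb_spaceD[OF kb, where M = "norm z"] incseq_SucI norm_mono_pos)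
      (auto intro: diff_left_mono)
  then obtain l where l: "(\<lambda>k. z - v k) \<longlonglongrightarrow> l" by (auto simp: convergent_def)
  define r where "r = z - l"
  have r: "v \<longlonglongrightarrow> r" using tendsto_diff[OF tendsto_const l, of z] by (simp add: r_def)
  have "(\<lambda>k. f (v k)) \<longlonglongrightarrow> f r" by (intro blinfun.tendsto tendsto_const r)
  moreover have "(\<lambda>k. g z * (1/2) ^ k * 2) \<longlonglongrightarrow> g z * 0 * 2"
    by (intro tendsto_mult tendsto_const LIMSEQ_power_zero) simp
  ultimately have "f r \<le> 0" using fv LIMSEQ_le by fastforce
  moreover have r0: "0 \<le> r" using tendsto_nonneg[OF r] vpos by blast
  moreover have "r \<le> z" using tendsto_le_lattice[OF r tendsto_const] vz by blast
  ultimately have "r = 0" using strict dual_posD[OF f r0] by (metis antisym)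
  have "(\<lambda>k. g (v k)) \<longlonglongrightarrow> g r" by (intro blinfun.tendsto tendsto_const r)
  moreover have "e \<le> g (v k)" for k using gw[of k] dual_pos_mono[OF g wv, of k] by linarith
  ultimately have "e \<le> g r" by (intro LIMSEQ_le_const) auto
  with \<open>r = 0\<close> e show False by (simp add: blinfun.zero_right)
qed

section \<open>Order continuous functionals on the dual of a KB-space\<close>

text \<open>One half of a Hahn decomposition for \<open>\<psi> - \<lambda> u\<close> on \<open>[0, f]\<close>: repeatedly remove from \<open>f\<close> a part
  that is within a factor 2 of being as negative as possible. The removed parts cannot stay
  substantially negative, so the pointwise limit of what remains has no negative part.\<close>

lemma hahn_positive_set:
  fixes \<psi> :: "('a::banach_lattice \<Rightarrow>\<^sub>L real) \<Rightarrow> real"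
  assumes diff: "\<And>g h. \<psi> (g - h) = \<psi> g - \<psi> h" and pos: "\<And>g. dual_le 0 g \<Longrightarrow> 0 \<le> \<psi> g"
    and cont: "\<And>h. (\<And>n. dual_le 0 (h n) \<and> dual_le (h n) f) \<Longrightarrow>
      (\<And>x. (\<lambda>n. blinfun_apply (h n) x) \<longlonglongrightarrow> 0) \<Longrightarrow> (\<lambda>n::nat. \<psi> (h n)) \<longlonglongrightarrow> 0"
    and f: "dual_le 0 f" and u: "0 \<le> u" and l: "0 \<le> l"
  obtains f' where "dual_le 0 f'" "dual_le f' f" "\<psi> f - l * f u \<le> \<psi> f' - l * f' u"
    "\<And>g. dual_le 0 g \<Longrightarrow> dual_le g f' \<Longrightarrow> l * g u \<le> \<psi> g"
proof -
  define \<mu> where "\<mu> g = \<psi> g - l * blinfun_apply g u" for g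
  have \<mu>_diff: "\<mu> (g - h) = \<mu> g - \<mu> h" for g h
    by (simp add: \<mu>_def diff blinfun.diff_left algebra_simps)
  have \<mu>0: "\<mu> 0 = 0" using \<mu>_diff[of 0 0] by simp
  define worst where "worst h g \<longleftrightarrow> dual_le 0 g \<and> dual_le g h \<and> \<mu> g \<le> 0 \<and>
    (\<forall>g'. dual_le 0 g' \<and> dual_le g' h \<longrightarrow> 2 * \<mu> g \<le> \<mu> g')" for h g
  have "\<exists>g. worst h g" if h: "dual_le 0 h" for h
  proof -
    define I where "I = {g. dual_le 0 g \<and> dual_le g h}"
    have 0: "0 \<in> I" using h by (simp add: I_def)
    have bdd: "bdd_below (\<mu> ` I)"
    proof (rule bdd_belowI2)
      fix g assume "g \<in> I"
      then have "0 \<le> \<psi> g" "l * g u \<le> l * h u"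
        using pos dual_leD[OF _ u] l by (auto simp: I_def intro: mult_left_mono)
      then show "- (l * h u) \<le> \<mu> g" by (simp add: \<mu>_def)
    qed
    define s where "s = (INF g\<in>I. \<mu> g)"
    have s: "s \<le> \<mu> g" if "g \<in> I" for g unfolding s_def using bdd that by (rule cINF_lower)
    show ?thesis
    proof (cases "s = 0")
      case True
      then show ?thesis using s h by (intro exI[of _ 0]) (auto simp: worst_def \<mu>0 I_def)
    next
      case False
      then have "s < s / 2" using s[OF 0] \<mu>0 by simp
      then obtain g where "g \<in> I" "\<mu> g < s / 2"
        using cINF_less_iff[OF _ bdd, of "s / 2"] 0 unfolding s_def by blast
      moreover have "\<mu> g \<le> 0" using \<open>\<mu> g < s / 2\<close> s[OF 0] \<mu>0 by simp
      moreover have "2 * \<mu> g \<le> \<mu> g'" if "g' \<in> I" for g'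
        using s[OF that] \<open>\<mu> g < s / 2\<close> by linarith
      ultimately have "worst h g" by (simp add: worst_def I_def)
      then show ?thesis by blast
    qed
  qed
  then have worst: "dual_le 0 h \<Longrightarrow> worst h (SOME g. worst h g)" for h by (meson someI_ex)
  define G where "G h = (SOME g. worst h g)" for h
  define F where "F = rec_nat f (\<lambda>n h. h - G h)"
  have F0: "F 0 = f" and FS: "F (Suc n) = F n - G (F n)" for n by (simp_all add: F_def)
  have Fpos: "dual_le 0 (F n)" for n
  proof (induction n)
    case (Suc n)
    then show ?case using worst[OF Suc] by (simp add: FS G_def worst_def dual_le_def blinfun.diff_left)
  qed (simp add: F0 f)
  have G: "dual_le 0 (G (F n))" "dual_le (G (F n)) (F n)" "\<mu> (G (F n)) \<le> 0"
      "\<And>g. dual_le 0 g \<Longrightarrow> dual_le g (F n) \<Longrightarrow> 2 * \<mu> (G (F n)) \<le> \<mu> g" for n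
    using worst[OF Fpos, of n] by (auto simp: G_def worst_def)
  have dec: "dual_le (F (Suc n)) (F n)" for n
    using G(1)[of n] by (simp add: FS dual_le_def blinfun.diff_left)
  obtain f' where f': "dual_le 0 f'" "\<And>n. dual_le f' (F n)"
      "\<And>x. (\<lambda>n. F n x) \<longlonglongrightarrow> blinfun_apply f' x"
    by (rule decreasing_dual_limit[of F, OF Fpos dec]) (rule that)
  have Ff: "dual_le (F n) f" for n
    by (induction n) (auto simp: F0 intro: dual_le_trans[OF dec])
  have \<mu>F: "\<mu> (F (Suc n)) = \<mu> (F n) - \<mu> (G (F n))" for n by (simp add: FS \<mu>_diff)
  have inc: "incseq (\<lambda>n. \<mu> (F n))" using \<mu>F G(3) by (intro incseq_SucI) simp
  have "(\<lambda>n. \<psi> (F n - f')) \<longlonglongrightarrow> 0"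
  proof (rule cont)
    show "dual_le 0 (F n - f') \<and> dual_le (F n - f') f" for n
      using f'(1) f'(2)[of n] Ff[of n] by (auto simp: dual_le_def blinfun.diff_left) (smt (verit))
    show "(\<lambda>n. (F n - f') x) \<longlonglongrightarrow> 0" for x
      using tendsto_diff[OF f'(3)[of x] tendsto_const[of "f' x"]] by (simp add: blinfun.diff_left)
  qed
  from tendsto_add[OF this tendsto_const[of "\<psi> f'"]]
  have "(\<lambda>n. \<psi> (F n)) \<longlonglongrightarrow> \<psi> f'" by (simp add: diff)
  then have lim: "(\<lambda>n. \<mu> (F n)) \<longlonglongrightarrow> \<mu> f'"
    unfolding \<mu>_def by (intro tendsto_diff tendsto_mult tendsto_const f'(3))
  have "\<mu> f \<le> \<mu> f'" using incseq_le[OF inc lim, of 0] by (simp add: F0)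
  moreover have "l * g u \<le> \<psi> g" if g: "dual_le 0 g" "dual_le g f'" for g
  proof -
    have "(\<lambda>n. 2 * (\<mu> (F n) - \<mu> (F (Suc n)))) \<longlonglongrightarrow> 2 * (\<mu> f' - \<mu> f')"
      by (intro tendsto_mult tendsto_diff tendsto_const lim LIMSEQ_Suc)
    moreover have "2 * (\<mu> (F n) - \<mu> (F (Suc n))) \<le> \<mu> g" for n
      using G(4)[OF g(1), of n] dual_le_trans[OF g(2) f'(2)[of n]] \<mu>F[of n] by simp
    ultimately have "2 * (\<mu> f' - \<mu> f') \<le> \<mu> g" by (intro LIMSEQ_le_const2) auto
    then show ?thesis by (simp add: \<mu>_def)
  qed
  moreover have "dual_le f' f" using f'(2)[of 0] by (simp add: F0)
  ultimately show ?thesis using that f'(1) by (simp add: \<mu>_def)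
qed

text \<open>For \<open>y, z \<in> E\<close> the value \<open>f(y \<or> z)\<close> splits as \<open>f\<^sub>1(y) + f\<^sub>2(z)\<close> with \<open>f = f\<^sub>1 + f\<^sub>2\<close>, so the elements
  of \<open>E\<close> that lie below a given functional on \<open>E\<^sup>*\<close> are closed under suprema.\<close>

lemma sup_le_bidual:
  fixes \<phi> :: "('a::banach_lattice \<Rightarrow>\<^sub>L real) \<Rightarrow> real"
  assumes add: "\<And>g h. \<phi> (g + h) = \<phi> g + \<phi> h"
    and y: "\<And>f. dual_le 0 f \<Longrightarrow> blinfun_apply f y \<le> \<phi> f"
    and z: "\<And>f. dual_le 0 f \<Longrightarrow> blinfun_apply f z \<le> \<phi> f" and f: "dual_le 0 f"
  shows "blinfun_apply f (sup y z) \<le> \<phi> f"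
proof -
  obtain k where k: "dual_le 0 k" "dual_le k f" "k (z - y) = f (pprt (z - y))"
    using dual_restrict_to_pprt[OF f] by blast
  have fk: "dual_le 0 (f - k)" using k(2) by (simp add: dual_le_def blinfun.diff_left)
  have "f (sup y z) = (f - k) y + k z"
    using k(3) by (simp add: sup_eq_add_pprt blinfun.bilinear_simps)
  also have "\<dots> \<le> \<phi> (f - k) + \<phi> k" using y[OF fk] z[OF k(1)] by simp
  also have "\<dots> = \<phi> f" by (simp flip: add)
  finally show ?thesis .
qed

text \<open>The heart of the matter. Let \<open>x\<close> be the largest element of \<open>E\<close> below \<open>\<phi>\<close>, and
  \<open>\<psi> = \<phi> - x\<close>. If \<open>\<psi> \<noteq> 0\<close> then absolute continuity and the Hahn decomposition give \<open>u \<ge> 0\<close>, \<open>\<lambda> > 0\<close>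
  and \<open>f' \<ge> 0\<close> with \<open>f'(u) > 0\<close> and \<open>\<psi> \<ge> \<lambda> u\<close> on \<open>[0, f']\<close>. Let \<open>z\<close> be the component of \<open>u\<close> on which
  \<open>f'\<close> is strictly positive. Truncating \<open>g\<close> to multiples of \<open>f'\<close> then shows \<open>\<psi>(g) \<ge> \<lambda> g(z)\<close> for
  all \<open>g \<ge> 0\<close>, so \<open>x + \<lambda> z\<close> is still below \<open>\<phi>\<close>, although \<open>z \<noteq> 0\<close>.\<close>

lemma kb_space_closure_is_evaluation:
  fixes B :: "'a::banach_lattice set"
  assumes kb: "kb_space TYPE('a)" and null: "null_on_order_bounded_disjoint B"
    and pos: "\<And>x. x \<in> B \<Longrightarrow> 0 \<le> x" and bdd: "bounded B" and \<phi>: "\<phi> \<in> closure (evaluation ` B)"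
  shows "\<phi> \<in> range evaluation"
proof -
  note \<phi>_add = closure_evaluation_add[OF \<phi>] and \<phi>_diff = closure_evaluation_diff[OF \<phi>]
    and \<phi>_scaleR = closure_evaluation_scaleR[OF \<phi>]
  have \<phi>_pos: "0 \<le> \<phi> f" if "dual_le 0 f" for f
    using closure_evaluation_nonneg[OF \<phi> pos that] .
  define D where "D = {y. 0 \<le> y \<and> (\<forall>f. dual_le 0 f \<longrightarrow> blinfun_apply f y \<le> \<phi> f)}"
  obtain x where x: "x \<in> D" "\<And>y. y \<in> D \<Longrightarrow> y \<le> x"
  proof (rule kb_space_greatest[OF kb, of D])
    show "D \<noteq> {}" using \<phi>_pos by (auto simp: D_def blinfun.zero_right intro!: exI[of _ 0])
    show "sup y z \<in> D" if "y \<in> D" "z \<in> D" for y z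
      using that sup_le_bidual[OF \<phi>_add, of y z] by (auto simp: D_def intro: le_supI1)
    show "closed D"
      unfolding closed_sequential_limits
    proof (intro allI impI, elim conjE)
      fix s l assume s: "\<forall>n. s n \<in> D" and l: "s \<longlonglongrightarrow> l"
      have "0 \<le> l" using s by (intro tendsto_nonneg[OF l, of 0]) (simp add: D_def)
      moreover have "f l \<le> \<phi> f" if "dual_le 0 f" for f :: "'a \<Rightarrow>\<^sub>L real"
      proof (rule LIMSEQ_le_const2)
        show "(\<lambda>n. f (s n)) \<longlonglongrightarrow> f l" by (intro blinfun.tendsto tendsto_const l)
        show "\<exists>N. \<forall>n\<ge>N. f (s n) \<le> \<phi> f" using s that by (auto simp: D_def)
      qed
      ultimately show "l \<in> D" by (simp add: D_def)
    qed
    show "bounded D"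
    proof -
      obtain M where M: "\<And>x. x \<in> B \<Longrightarrow> norm x \<le> M" using bdd by (auto simp: bounded_iff)
      have "norm y \<le> M" if y: "y \<in> D" for y
      proof -
        obtain f :: "'a \<Rightarrow>\<^sub>L real" where f: "dual_le 0 f" "\<And>y. \<bar>f y\<bar> \<le> norm y" "f y = norm (pprt y)"
          using exists_positive_norming_functional by blast
        have "norm y = f y" using f(3) y by (simp add: D_def)
        also have "\<dots> \<le> \<phi> f" using y f(1) by (simp add: D_def)
        also have "\<dots> \<le> M"
        proof (rule closure_evaluation_le[OF \<phi>])
          fix w assume "w \<in> B"
          then show "f w \<le> M" using f(2)[of w] M[of w] by linarith
        qed
        finally show ?thesis .
      qed
      then show ?thesis by (auto simp: bounded_iff)
    qed
  qed (auto simp: D_def)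
  define \<psi> where "\<psi> f = \<phi> f - f x" for f :: "'a \<Rightarrow>\<^sub>L real"
  have \<psi>_diff: "\<psi> (g - h) = \<psi> g - \<psi> h" for g h by (simp add: \<psi>_def \<phi>_diff blinfun.diff_left)
  have \<psi>_scaleR: "\<psi> (c *\<^sub>R g) = c * \<psi> g" for c g
    by (simp add: \<psi>_def \<phi>_scaleR blinfun.scaleR_left algebra_simps)
  have x0: "0 \<le> x" using x(1) by (simp add: D_def)
  have \<psi>_pos: "0 \<le> \<psi> f" if "dual_le 0 f" for f using x(1) that by (simp add: D_def \<psi>_def)
  have \<psi>_mono: "\<psi> g \<le> \<psi> h" if "dual_le g h" for g h
    using \<psi>_pos[of "h - g"] that by (simp add: \<psi>_diff dual_le_def blinfun.diff_left)
  have \<psi>_le: "\<psi> f \<le> \<phi> f" if "dual_le 0 f" for f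
    using dual_posD[OF that x0] by (simp add: \<psi>_def)
  have ac: "\<exists>u d. 0 \<le> u \<and> 0 < d \<and>
      (\<forall>g. dual_le 0 g \<and> dual_le g f \<and> blinfun_apply g u \<le> d \<longrightarrow> \<psi> g \<le> e)"
    if "dual_le 0 f" "0 < e" for f e
    using closure_evaluation_absolutely_continuous[OF \<phi> null pos bdd that] \<psi>_le order_trans by meson
  have cont: "(\<lambda>n. \<psi> (h n)) \<longlonglongrightarrow> 0"
    if f: "dual_le 0 f" and h: "\<And>n. dual_le 0 (h n) \<and> dual_le (h n) f"
      and lim: "\<And>y. (\<lambda>n. blinfun_apply (h n) y) \<longlonglongrightarrow> 0" for f and h :: "nat \<Rightarrow> 'a \<Rightarrow>\<^sub>L real"
  proof (rule tendstoI)
    fix e :: real assume e: "0 < e"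
    obtain u d where u: "0 < d" "\<And>g. dual_le 0 g \<Longrightarrow> dual_le g f \<Longrightarrow> blinfun_apply g u \<le> d \<Longrightarrow> \<psi> g \<le> e / 2"
      using ac[OF f, of "e / 2"] e by auto
    have "eventually (\<lambda>n. h n u < d) sequentially" using lim[of u] u(1) by (rule order_tendstoD)
    then show "eventually (\<lambda>n. dist (\<psi> (h n)) 0 < e) sequentially"
    proof (rule eventually_mono)
      fix n assume "h n u < d"
      then have "\<psi> (h n) \<le> e / 2" using u(2)[of "h n"] h by simp
      moreover have "0 \<le> \<psi> (h n)" using \<psi>_pos h by blast
      ultimately show "dist (\<psi> (h n)) 0 < e" using e by simp
    qed
  qed
  have zero: "\<psi> f = 0" if f: "dual_le 0 f" for f
  proof (rule ccontr)
    assume "\<psi> f \<noteq> 0"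
    define e where "e = \<psi> f / 2"
    have e: "0 < e" using \<psi>_pos[OF f] \<open>\<psi> f \<noteq> 0\<close> by (simp add: e_def)
    obtain u d where u: "0 \<le> u" "0 < d"
        "\<And>g. dual_le 0 g \<Longrightarrow> dual_le g f \<Longrightarrow> blinfun_apply g u \<le> d \<Longrightarrow> \<psi> g \<le> e"
      using ac[OF f e] by blast
    define l where "l = e / (2 * (1 + f u))"
    have fu: "0 \<le> f u" using dual_posD[OF f u(1)] .
    have l: "0 < l" using e fu by (simp add: l_def)
    have "l * f u \<le> l * (1 + f u)" using l by simp
    also have "\<dots> = e / 2" using fu by (simp add: l_def field_simps)
    finally have lfu: "l * f u \<le> e / 2" .
    obtain f' where f': "dual_le 0 f'" "dual_le f' f" "\<psi> f - l * f u \<le> \<psi> f' - l * f' u"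
        "\<And>g. dual_le 0 g \<Longrightarrow> dual_le g f' \<Longrightarrow> l * g u \<le> \<psi> g"
      by (rule hahn_positive_set[OF \<psi>_diff \<psi>_pos cont[OF f] f u(1) less_imp_le[OF l]];
        (assumption | (rule that; assumption)))
    have f'u0: "0 \<le> f' u" using dual_posD[OF f'(1) u(1)] .
    have "e < \<psi> f'"
      using f'(3) lfu e mult_nonneg_nonneg[OF less_imp_le[OF l] f'u0] by (simp add: e_def)
    then have "f' u \<noteq> 0" using u(2) u(3)[OF f'(1,2)] by auto
    with f'u0 have f'u: "0 < f' u" by simp
    \<comment> \<open>Remove from \<open>u\<close> the largest part on which \<open>f'\<close> vanishes.\<close>
    define N where "N = {w. 0 \<le> w \<and> w \<le> u \<and> f' w = 0}"
    obtain w0 where w0: "w0 \<in> N" "\<And>w. w \<in> N \<Longrightarrow> w \<le> w0"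
    proof (rule kb_space_greatest[OF kb, of N])
      show "N \<noteq> {}" using u(1) by (auto simp: N_def blinfun.zero_right intro!: exI[of _ 0])
      show "sup y z \<in> N" if "y \<in> N" "z \<in> N" for y z
      proof -
        have yz: "0 \<le> y" "0 \<le> z" "y \<le> u" "z \<le> u" "f' y = 0" "f' z = 0"
          using that by (auto simp: N_def)
        have "sup y z \<le> y + z" using yz by (auto intro: add_increasing add_increasing2)
        then have "f' (sup y z) \<le> 0"
          using dual_pos_mono[OF f'(1), of "sup y z" "y + z"] yz by (simp add: blinfun.add_right)
        moreover have "0 \<le> sup y z" using yz by (auto intro: le_supI1)
        ultimately show ?thesis using yz dual_posD[OF f'(1), of "sup y z"] by (simp add: N_def)
      qed
      show "closed N"
        unfolding closed_sequential_limits
      proof (intro allI impI, elim conjE)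
        fix s k assume s: "\<forall>n. s n \<in> N" and k: "s \<longlonglongrightarrow> k"
        have "0 \<le> k" using s by (intro tendsto_nonneg[OF k, of 0]) (simp add: N_def)
        moreover have "k \<le> u"
          using s by (intro tendsto_le_lattice[OF k tendsto_const, of 0]) (simp add: N_def)
        moreover have "(\<lambda>n. f' (s n)) \<longlonglongrightarrow> f' k" by (intro blinfun.tendsto tendsto_const k)
        then have "f' k = 0" using s LIMSEQ_unique[OF _ tendsto_const, of 0 "f' k"] by (simp add: N_def)
        ultimately show "k \<in> N" by (simp add: N_def)
      qed
      show "bounded N" using norm_mono_pos[of _ u] by (auto simp: N_def bounded_iff)
    qed (auto simp: N_def)
    define z where "z = u - w0"
    have z: "0 \<le> z" "z \<le> u" "0 < f' z" using w0(1) f'u by (auto simp: N_def z_def blinfun.diff_right)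
    have strict: "w = 0" if w: "0 \<le> w" "w \<le> z" "f' w = 0" for w
    proof -
      have "w0 + w \<in> N"
        using w w0(1) by (auto simp: N_def z_def blinfun.add_right algebra_simps intro: add_nonneg_nonneg)
      then have "w0 + w \<le> w0" by (rule w0(2))
      with w(1) show "w = 0" by simp
    qed
    have below: "l * g z \<le> \<psi> g" if g: "dual_le 0 g" for g :: "'a \<Rightarrow>\<^sub>L real"
    proof (rule field_le_epsilon)
      fix d :: real assume d: "0 < d"
      have "0 < d / l" using d l by simp
      with kb f'(1) g z(1) strict have "\<exists>n::nat. dual_pprt (g - real n *\<^sub>R f') z \<le> d / l"
        by (rule kb_space_truncation)
      then obtain n :: nat where n: "dual_pprt (g - real n *\<^sub>R f') z \<le> d / l" by blast
      \<comment> \<open>\<open>h\<close> is the infimum of \<open>g\<close> and \<open>n f'\<close>. The multiple \<open>Suc n\<close> avoids dividing by zero.\<close>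
      define h where "h = g - dual_pprt (g - real n *\<^sub>R f')"
      have "dual_le (dual_pprt (g - real n *\<^sub>R f')) g"
        using f'(1) by (intro dual_pprt_minimal g)
          (auto simp: dual_le_def blinfun.bilinear_simps)
      then have h0: "dual_le 0 h" by (simp add: h_def dual_le_def blinfun.diff_left)
      have hg: "dual_le h g" using dual_pprt_nonneg by (simp add: h_def dual_le_def blinfun.diff_left)
      have "dual_le h (real n *\<^sub>R f')"
        using dual_pprt_ge_self[of "g - real n *\<^sub>R f'"]
        by (simp add: h_def dual_le_def blinfun.bilinear_simps algebra_simps)
      then have hf: "h y \<le> real (Suc n) * f' y" if "0 \<le> y" for y
        using dual_leD[OF _ that, of h "real n *\<^sub>R f'"] dual_posD[OF f'(1) that]
        by (simp add: blinfun.scaleR_left algebra_simps)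
      have "l * (inverse (real (Suc n)) *\<^sub>R h) u \<le> \<psi> (inverse (real (Suc n)) *\<^sub>R h)"
      proof (rule f'(4))
        show "dual_le 0 (inverse (real (Suc n)) *\<^sub>R h)"
          using h0 by (simp add: dual_le_def blinfun.scaleR_left)
        show "dual_le (inverse (real (Suc n)) *\<^sub>R h) f'"
        proof (rule dual_leI)
          fix y :: 'a assume "0 \<le> y"
          then have "inverse (real (Suc n)) * h y \<le> inverse (real (Suc n)) * (real (Suc n) * f' y)"
            by (intro mult_left_mono hf) auto
          also have "\<dots> = f' y" by (simp del: of_nat_Suc)
          finally show "(inverse (real (Suc n)) *\<^sub>R h) y \<le> f' y" by (simp add: blinfun.scaleR_left)
        qed
      qed
      then have "inverse (real (Suc n)) * (l * h u) \<le> inverse (real (Suc n)) * \<psi> h"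
        by (simp add: blinfun.scaleR_left \<psi>_scaleR mult.left_commute del: of_nat_Suc)
      then have "l * h u \<le> \<psi> h" by (rule mult_left_le_imp_le) simp
      moreover have "h z \<le> h u" using dual_pos_mono[OF h0 z(2)] .
      then have "l * h z \<le> l * h u" using l by simp
      moreover have "\<psi> h \<le> \<psi> g" using hg by (rule \<psi>_mono)
      moreover have "l * g z - l * h z \<le> l * (d / l)"
        using mult_left_mono[OF n less_imp_le[OF l]] by (simp add: h_def blinfun.diff_left algebra_simps)
      moreover have "l * (d / l) = d" using l by simp
      ultimately show "l * g z \<le> \<psi> g + d" by linarith
    qed
    have "0 \<le> x + l *\<^sub>R z"
      using x0 z(1) l by (intro add_nonneg_nonneg scaleR_nonneg_nonneg) auto
    then have "x + l *\<^sub>R z \<in> D"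
      using below by (auto simp: D_def \<psi>_def blinfun.bilinear_simps algebra_simps)
    then have "x + l *\<^sub>R z \<le> x" by (rule x(2))
    then have "l *\<^sub>R z \<le> 0" by simp
    then have "f' (l *\<^sub>R z) \<le> 0" using dual_pos_mono[OF f'(1)] by (metis blinfun.zero_right)
    then show False using l z(3) by (simp add: blinfun.scaleR_right mult_le_0_iff)
  qed
  have "\<phi> f = f x" for f :: "'a \<Rightarrow>\<^sub>L real"
  proof -
    have "\<psi> (dual_pprt f - dual_pprt (- f)) = 0" by (simp only: \<psi>_diff zero dual_pprt_nonneg)
    then show ?thesis by (simp add: \<psi>_def flip: dual_split)
  qed
  then have "\<phi> = evaluation x" by (simp add: evaluation_def fun_eq_iff)
  then show ?thesis by blast
qed

section \<open>The characterizations of KB-spaces\<close>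

text \<open>Every element of \<open>A\<close> is a difference of an element of \<open>pprt ` A\<close> and one of
  \<open>pprt ` uminus ` A\<close>. The weak* closures \<open>P\<close> and \<open>Q\<close> of these sets are compact and consist of elements
  of \<open>E\<close>. The same is true of the set of their differences, and this contains the weak* closure of \<open>A\<close>.\<close>

lemma kb_space_imp_rel_weakly_compact:
  fixes A :: "'a::banach_lattice set"
  assumes p: "1 \<le> p" and kb: "kb_space TYPE('a)" and A: "almost_p_limited p A"
  shows "rel_weakly_compact A"
proof -
  have part: "bounded (pprt ` A) \<and> closure (evaluation ` pprt ` A) \<subseteq> range evaluation"
    if "almost_p_limited p A" for A :: "'a set"
  proof -
    have "bounded A" using that by (rule almost_p_limited_bounded)
    then obtain M where "\<And>x. x \<in> A \<Longrightarrow> norm x \<le> M" by (auto simp: bounded_iff)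
    then have "\<And>x. x \<in> A \<Longrightarrow> norm (pprt x) \<le> M" using norm_pprt_le order_trans by blast
    then have bdd: "bounded (pprt ` A)" by (auto simp: bounded_iff)
    have "\<phi> \<in> range evaluation" if \<phi>: "\<phi> \<in> closure (evaluation ` pprt ` A)" for \<phi>
      using kb almost_p_limited_pprt_null[OF p \<open>almost_p_limited p A\<close>] _ bdd \<phi>
      by (rule kb_space_closure_is_evaluation) auto
    with bdd show ?thesis by blast
  qed
  define P where "P = closure (evaluation ` pprt ` A)"
  define Q where "Q = closure (evaluation ` pprt ` uminus ` A)"
  note parts = part[OF A] part[OF almost_p_limited_uminus[OF A]]
  have range: "P \<subseteq> range evaluation" "Q \<subseteq> range evaluation" using parts by (auto simp: P_def Q_def)
  have "compact (P \<times> Q)"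
    unfolding P_def Q_def using parts by (intro compact_Times compact_closure_evaluation) auto
  moreover have "continuous_on (P \<times> Q) (\<lambda>(a, b). \<lambda>f. a f - b f)"
    unfolding case_prod_beta
    by (intro continuous_on_coordinatewise_then_product continuous_on_diff
        continuous_on_product_then_coordinatewise[OF continuous_on_fst]
        continuous_on_product_then_coordinatewise[OF continuous_on_snd] continuous_on_id)
  ultimately have "compact ((\<lambda>(a, b). \<lambda>f. a f - b f) ` (P \<times> Q))"
    by (rule compact_continuous_image[rotated])
  then have closed: "closed ((\<lambda>(a, b). \<lambda>f. a f - b f) ` (P \<times> Q))" by (rule compact_imp_closed_function)
  have "evaluation x \<in> (\<lambda>(a, b). \<lambda>f. a f - b f) ` (P \<times> Q)" if "x \<in> A" for x
  proof (rule image_eqI)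
    have "evaluation (pprt x) \<in> P" unfolding P_def by (rule subsetD[OF closure_subset]) (simp add: that)
    moreover have "evaluation (pprt (- x)) \<in> Q"
      unfolding Q_def by (rule subsetD[OF closure_subset]) (simp add: that)
    ultimately show "(evaluation (pprt x), evaluation (pprt (- x))) \<in> P \<times> Q" by simp
    show "evaluation x = (case (evaluation (pprt x), evaluation (pprt (- x))) of
        (a, b) \<Rightarrow> \<lambda>f. a f - b f)"
      by (simp add: evaluation_def flip: blinfun.diff_right pprt_split)
  qed
  then have "closure (evaluation ` A) \<subseteq> (\<lambda>(a, b). \<lambda>f. a f - b f) ` (P \<times> Q)"
    using closed by (intro closure_minimal) auto
  also have "\<dots> \<subseteq> range evaluation"
  proof clarify
    fix a b assume "a \<in> P" "b \<in> Q"
    then obtain y z where "a = evaluation y" "b = evaluation z" using range by blast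
    then have "(\<lambda>f. a f - b f) = evaluation (y - z)" by (simp add: evaluation_def blinfun.diff_right)
    then show "(\<lambda>f. a f - b f) \<in> range evaluation" by blast
  qed
  finally show ?thesis using almost_p_limited_bounded[OF A] by (intro rel_weakly_compactI)
qed

lemma weakly_sequential_imp_kb_space:
  assumes p: "1 \<le> p"
    and conv: "\<And>x :: nat \<Rightarrow> 'a::banach_lattice. weakly_Cauchy x \<Longrightarrow> positive_p_limited p (range x) \<Longrightarrow>
      weakly_convergent x"
  shows "kb_space TYPE('a)"
  unfolding kb_space_def
proof (intro allI impI, elim conjE)
  fix x :: "nat \<Rightarrow> 'a"
  assume x: "incseq x" "\<forall>n. 0 \<le> x n" "bounded (range x)"
  have "weakly_Cauchy x" using x(1,3) by (rule increasing_weakly_Cauchy)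
  moreover have "positive_p_limited p (range x)"
    using x(2) by (intro increasing_positive_p_limited[OF p x(1) _ x(3)]) simp
  ultimately have "weakly_convergent x" by (rule conv)
  with x(1) show "convergent x" by (rule increasing_weakly_convergent_imp_convergent)
qed

theorem theorem4p1:
  fixes p :: real
  assumes "1 \<le> p"
  shows
    "((\<forall>A :: 'a::banach_lattice set. almost_p_limited p A \<longrightarrow> rel_weakly_compact A) \<longleftrightarrow>
      (\<forall>A :: 'a set. positive_p_limited p A \<longrightarrow> rel_weakly_compact A)) \<and>
     ((\<forall>A :: 'a set. positive_p_limited p A \<longrightarrow> rel_weakly_compact A) \<longleftrightarrow>
      kb_space TYPE('a)) \<and>
     (kb_space TYPE('a) \<longleftrightarrow>
      (\<forall>x :: nat \<Rightarrow> 'a. weakly_Cauchy x \<and> almost_p_limited p (range x) \<longrightarrow>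
         weakly_convergent x)) \<and>
     ((\<forall>x :: nat \<Rightarrow> 'a. weakly_Cauchy x \<and> almost_p_limited p (range x) \<longrightarrow>
         weakly_convergent x) \<longleftrightarrow>
      (\<forall>x :: nat \<Rightarrow> 'a. weakly_Cauchy x \<and> positive_p_limited p (range x) \<longrightarrow>
         weakly_convergent x))"
    (is "(?a \<longleftrightarrow> ?b) \<and> (?b \<longleftrightarrow> ?c) \<and> (?c \<longleftrightarrow> ?d) \<and> (?d \<longleftrightarrow> ?e)")
proof -
  have pa: "positive_p_limited p A \<Longrightarrow> almost_p_limited p A" for A :: "'a set"
    using assms by (rule positive_imp_almost_p_limited)
  have "?a \<Longrightarrow> ?b" using pa by blast
  moreover have "?b \<Longrightarrow> ?e" using weakly_Cauchy_rel_compact_imp_convergent by blast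
  moreover have "?a \<Longrightarrow> ?d" using weakly_Cauchy_rel_compact_imp_convergent by blast
  moreover have "?d \<Longrightarrow> ?e" using pa by blast
  moreover have "?e \<Longrightarrow> ?c" using weakly_sequential_imp_kb_space[OF assms] by blast
  moreover have "?c \<Longrightarrow> ?a" using kb_space_imp_rel_weakly_compact[OF assms] by blast
  ultimately show ?thesis by argo
qed

end
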